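(* Let $C\subset\mathbb{R}^n$ be a polyhedral set, $M$ an $n\times n$ matrix, and let $S(q)=\{x\in\mathbb{R}^n\mid0\in q+Mx+N_C(x)\}$ for $q\in\mathbb{R}^n$. Let $Q\subseteq\operatorname{dom} S$ be a polyhedral set, $(\bar q,\bar x)\in\operatorname{gph} S|_Q$, and $\bar v:=-M\bar x-\bar q$. Suppose that the constraint qualification $$N_Q(\bar q)\cap(F_1-F_2)\cap\big(M(F_1-F_2)\big)^*=\{0\}\qquad(\mathrm{CQ})$$ holds for all closed faces $F_1,F_2\in\mathcal{F}(K(\bar x,\bar v))$ with $F_2\subset F_1$. If for all such $F_1,F_2$ $$(F_1-F_2)\cap\big(M(F_1-F_2)\big)^*\subseteq-N_Q(\bar q),\qquad(\mathrm{GCF})$$ then $S$ has the Lipschitz-like property relative to $Q$ at $\bar q$ for $\bar x$. The condition $(\mathrm{GCF})$ (for all such $F_1,F_2$) becomes also necessary for this property if either $\operatorname{gph}N_C$ is regular around $(\bar x,\bar v)$ or $Q=\operatorname{dom} S$; in the latter case the constraint qualification $(\mathrm{CQ})$ is not needed.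
   Context: A polyhedral set is an intersection of finitely many closed half-spaces or hyperplanes. $\operatorname{gph} S=\{(q,x)\mid x\in S(q)\}$, $\operatorname{dom} S=\{q\mid S(q)\neq\emptyset\}$, $S|_Q(q)=S(q)$ if $q\in Q$ and $\emptyset$ otherwise. For a set $A$: $A^*=\{v\mid\langle v,x\rangle\le0\ \forall x\in A\}$ (polar cone), $A^\perp$ is the orthogonal complement, and $[v]=\{\lambda v\mid\lambda\in\mathbb{R}\}$. $F_1-F_2=\{a-b\mid a\in F_1,b\in F_2\}$, $M(A)=\{Ma\mid a\in A\}$. The inclusion symbol $\subset$ allows equality. $T_C(x)$ is the contingent cone, $\widehat N_C(x)=T_C(x)^*$ the regular normal cone, $N_C(x)$ the limiting normal cone (limits of $v_k\in\widehat N_C(x_k)$, $x_k\to x$ in $C$); for convex sets $N_C$ is the usual normal cone of convex analysis. A set $D$ is regular around a point if it is locally closed and $\widehat N_D=N_D$ at each of its points in some neighborhood of that point. $\operatorname{gph}N_C=\{(x,v)\mid v\in N_C(x)\}$. Critical cone of $C$ at $(x,v)\in\operatorname{gph}N_C$: $K(x,v)=T_C(x)\cap[v]^\perp$. For a polyhedral cone $K$, $\mathcal{F}(K)$ is the collection of all closed faces of $K$, i.e. sets $F=K\cap[v^*]^\perp$ with $v^*\in K^*$. $S$ is Lipschitz-like relative to $Q$ at $\bar q\in Q$ for $\bar x\in S(\bar q)$ if $\operatorname{gph} S$ is locally closed at $(\bar q,\bar x)$ and there are neighborhoods $V$ of $\bar q$, $W$ of $\bar x$ and $\kappa\ge0$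 with $S(q')\cap W\subset S(q)+\kappa\|q'-q\|\mathbb{B}$ for all $q,q'\in Q\cap V$, where $\mathbb{B}$ is the closed unit ball. *)

theory Defs
  imports "HOL-Analysis.Analysis"
begin

definition gph :: "('a \<Rightarrow> 'b set) \<Rightarrow> ('a \<times> 'b) set" where
  "gph S = {(q, x). x \<in> S q}"

definition mdom :: "('a \<Rightarrow> 'b set) \<Rightarrow> 'a set" where
  "mdom S = {q. S q \<noteq> {}}"

definition mrestrict :: "('a \<Rightarrow> 'b set) \<Rightarrow> 'a set \<Rightarrow> 'a \<Rightarrow> 'b set" where
  "mrestrict S Q q = (if q \<in> Q then S q else {})"

definition polar_cone :: "'a::real_inner set \<Rightarrow> 'a set" where
  "polar_cone A = {v. \<forall>x\<in>A. v \<bullet> x \<le> 0}"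

definition difference_set :: "'a::ab_group_add set \<Rightarrow> 'a set \<Rightarrow> 'a set" where
  "difference_set A B = {a - b |a b. a \<in> A \<and> b \<in> B}"

definition locally_closed_at :: "'a::metric_space set \<Rightarrow> 'a \<Rightarrow> bool" where
  "locally_closed_at D z \<longleftrightarrow> (\<exists>e>0. closed (D \<inter> cball z e))"

definition contingent_cone :: "'a::euclidean_space set \<Rightarrow> 'a \<Rightarrow> 'a set" where
  "contingent_cone C x = {w. \<exists>(t :: nat \<Rightarrow> real) (u :: nat \<Rightarrow> 'a).
      (\<forall>k. t k > 0) \<and> t \<longlonglongrightarrow> 0 \<and> u \<longlonglongrightarrow> w \<and> (\<forall>k. x + t k *\<^sub>R u k \<in> C)}"

text \<open>Both normal cones are empty at points outside the set. The limiting normal cone is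
  used for convex sets as well, where it coincides with the normal cone of convex analysis.\<close>

definition regular_normal_cone :: "'a::euclidean_space set \<Rightarrow> 'a \<Rightarrow> 'a set" where
  "regular_normal_cone C x = (if x \<in> C then polar_cone (contingent_cone C x) else {})"

definition limiting_normal_cone :: "'a::euclidean_space set \<Rightarrow> 'a \<Rightarrow> 'a set" where
  "limiting_normal_cone C x = {v. x \<in> C \<and> (\<exists>(y :: nat \<Rightarrow> 'a) (w :: nat \<Rightarrow> 'a).
      (\<forall>k. y k \<in> C \<and> w k \<in> regular_normal_cone C (y k)) \<and> y \<longlonglongrightarrow> x \<and> w \<longlonglongrightarrow> v)}"

definition regular_around :: "'a::euclidean_space set \<Rightarrow> 'a \<Rightarrow> bool" where
  "regular_around D z \<longleftrightarrow> (\<exists>e>0. \<forall>y \<in> D \<inter> ball z e.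
      locally_closed_at D y \<and> regular_normal_cone D y = limiting_normal_cone D y)"

definition critical_cone :: "'a::euclidean_space set \<Rightarrow> 'a \<Rightarrow> 'a \<Rightarrow> 'a set" where
  "critical_cone C x v = contingent_cone C x \<inter> orthogonal_comp (span {v})"

definition closed_faces :: "'a::euclidean_space set \<Rightarrow> 'a set set" where
  "closed_faces K = {K \<inter> orthogonal_comp (span {w}) |w. w \<in> polar_cone K}"

definition lipschitz_like_rel ::
  "('a::euclidean_space \<Rightarrow> 'b::euclidean_space set) \<Rightarrow> 'a set \<Rightarrow> 'a \<Rightarrow> 'b \<Rightarrow> bool" where
  "lipschitz_like_rel S Q qb xb \<longleftrightarrow>
     qb \<in> Q \<and> xb \<in> S qb \<and> locally_closed_at (gph S) (qb, xb) \<and>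
     (\<exists>V W \<kappa>. open V \<and> qb \<in> V \<and> open W \<and> xb \<in> W \<and> \<kappa> \<ge> 0 \<and>
        (\<forall>q \<in> Q \<inter> V. \<forall>q' \<in> Q \<inter> V.
           S q' \<inter> W \<subseteq> {x + (\<kappa> * norm (q' - q)) *\<^sub>R b |x b. x \<in> S q \<and> b \<in> cball 0 1}))"

definition avi_solution ::
  "(real^'n) set \<Rightarrow> real^'n^'n \<Rightarrow> real^'n \<Rightarrow> (real^'n) set" where
  "avi_solution C M q = {x. 0 \<in> {q + M *v x + v |v. v \<in> limiting_normal_cone C x}}"

definition face_normals :: "real^'n^'n \<Rightarrow> (real^'n) set \<Rightarrow> (real^'n) set \<Rightarrow> (real^'n) set" where
  "face_normals M F1 F2 =
     difference_set F1 F2 \<inter> polar_cone ((\<lambda>x. M *v x) ` difference_set F1 F2)"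

text \<open>In the following two conditions \<open>K\<close> stands for the critical cone
  of \<open>C\<close> at the reference point.\<close>

definition constraint_qualification ::
  "real^'n^'n \<Rightarrow> (real^'n) set \<Rightarrow> (real^'n) set \<Rightarrow> real^'n \<Rightarrow> bool" where
  "constraint_qualification M K Q qb \<longleftrightarrow>
     (\<forall>F1 \<in> closed_faces K. \<forall>F2 \<in> closed_faces K. F2 \<subseteq> F1 \<longrightarrow>
        limiting_normal_cone Q qb \<inter> face_normals M F1 F2 = {0})"

definition generalized_critical_face_condition ::
  "real^'n^'n \<Rightarrow> (real^'n) set \<Rightarrow> (real^'n) set \<Rightarrow> real^'n \<Rightarrow> bool" where
  "generalized_critical_face_condition M K Q qb \<longleftrightarrow>
     (\<forall>F1 \<in> closed_faces K. \<forall>F2 \<in> closed_faces K. F2 \<subseteq> F1 \<longrightarrow>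
        face_normals M F1 F2 \<subseteq> uminus ` limiting_normal_cone Q qb)"

end

theory Submission imports Defs begin

text \<open>Near a point of its graph, the normal cone map of \<open>C\<close> is a translate of the normal cone map of
  the critical cone there, and the critical cones of \<open>K\<close> at the points of \<open>gph N_K\<close> are exactly the
  differences \<open>F1 - F2\<close> of nested closed faces of \<open>K\<close>. So the infinitesimal behaviour of \<open>S\<close> at points
  near \<open>(qb, xb)\<close> is that of the inclusions \<open>0 \<in> d + M w + N_L(w)\<close> with \<open>L = F1 - F2\<close>.

  Sufficiency: if \<open>p\<close> is the point closest to \<open>d\<close> among the right-hand sides for which such an inclusion is
  solvable, then \<open>z = p - d\<close> belongs to \<open>L' \<inter> (M L')*\<close> for some critical cone \<open>L'\<close> of \<open>L\<close>, again
  a face difference of \<open>K\<close>. The face condition gives \<open>z \<bullet> d \<ge> 0\<close>, while \<open>z \<bullet> p = 0\<close> since the range is a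
  cone; hence \<open>p = d\<close>. So one can follow solutions along segments of \<open>Q\<close>, at a speed that is
  bounded because only finitely many polyhedral cones occur. Necessity: one small Lipschitz step
  at a graph point with critical cone \<open>L\<close> gives \<open>- d \<in> M(L) + L*\<close> for every feasible direction \<open>d\<close>, which
  is dual to the face condition. If \<open>Q\<close> is the domain of \<open>S\<close>, all face differences arise at graph
  points over \<open>Q\<close>; under regularity \<open>K\<close> is a subspace and \<open>K\<close> itself is the only face difference.\<close>

section \<open>Normal cones of polyhedra\<close>

text \<open>The normal cone of convex analysis, empty off \<open>C\<close>. Regular and limiting
  normal cones of closed convex sets reduce to it, which replaces limits by one global
  inequality.\<close>

definition normal_cone :: "'a::real_inner set \<Rightarrow> 'a \<Rightarrow> 'a set" where
  "normal_cone C x = {v. x \<in> C \<and> (\<forall>y\<in>C. v \<bullet> (y - x) \<le> 0)}"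

lemma convex_segment_mem:
  fixes C :: "'a::real_vector set"
  assumes "convex C" "x \<in> C" "x + t *\<^sub>R w \<in> C" "0 \<le> s" "s \<le> t"
  shows "x + s *\<^sub>R w \<in> C"
proof (cases "t = 0")
  case False
  then have "(1 - s/t) *\<^sub>R x + (s/t) *\<^sub>R (x + t *\<^sub>R w) \<in> C"
    using assms by (intro convexD) auto
  moreover have "(1 - s/t) *\<^sub>R x + (s/t) *\<^sub>R (x + t *\<^sub>R w) = x + s *\<^sub>R w"
    using False by (simp add: algebra_simps)
  ultimately show ?thesis by simp
qed (use assms in auto)

lemma contingent_cone_radial:
  assumes "convex C" "x \<in> C" "t > 0" "x + t *\<^sub>R w \<in> C"
  shows "w \<in> contingent_cone C x"
proof -
  define \<tau> where "\<tau> k = t * inverse (real (Suc k))" for k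
  have "\<tau> \<longlonglongrightarrow> 0"
    unfolding \<tau>_def using tendsto_mult_right_zero[OF LIMSEQ_inverse_real_of_nat] .
  moreover have "x + \<tau> k *\<^sub>R w \<in> C" and "\<tau> k > 0" for k
    using assms by (auto intro!: convex_segment_mem[OF assms(1,2,4)] simp: \<tau>_def field_simps)
  ultimately show ?thesis
    unfolding contingent_cone_def by (intro CollectI exI[of _ \<tau>] exI[of _ "\<lambda>_. w"]) auto
qed

text \<open>Points \<open>x + t k u k\<close> of \<open>C\<close> give
  \<open>v \<bullet> u k \<le> 0\<close> after division by \<open>t k\<close>, and this passes to
  the limit; conversely \<open>y - x\<close> is a radial, hence contingent, direction for every
  \<open>y\<close> in \<open>C\<close>.\<close>

lemma regular_normal_cone_convex:
  assumes "convex C"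
  shows "regular_normal_cone C x = normal_cone C x"
proof (cases "x \<in> C")
  case True
  have "v \<in> polar_cone (contingent_cone C x) \<longleftrightarrow> (\<forall>y\<in>C. v \<bullet> (y - x) \<le> 0)" for v
  proof
    assume v: "v \<in> polar_cone (contingent_cone C x)"
    have "y - x \<in> contingent_cone C x" if "y \<in> C" for y
      using contingent_cone_radial[OF assms True, of 1 "y - x"] that by simp
    with v show "\<forall>y\<in>C. v \<bullet> (y - x) \<le> 0"
      by (auto simp: polar_cone_def)
  next
    assume v: "\<forall>y\<in>C. v \<bullet> (y - x) \<le> 0"
    have "v \<bullet> w \<le> 0" if "w \<in> contingent_cone C x" for w
    proof -
      from that obtain t u where tu: "\<forall>k::nat. t k > 0" "u \<longlonglongrightarrow> w" "\<forall>k. x + t k *\<^sub>R u k \<in> C"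
        unfolding contingent_cone_def by blast
      have "v \<bullet> u k \<le> 0" for k
        using bspec[OF v tu(3)[rule_format, of k]] tu(1)[rule_format, of k]
        by (simp add: mult_le_0_iff)
      moreover have "(\<lambda>k. v \<bullet> u k) \<longlonglongrightarrow> v \<bullet> w"
        by (intro tendsto_intros tu)
      ultimately show ?thesis
        by (intro LIMSEQ_le_const2) auto
    qed
    then show "v \<in> polar_cone (contingent_cone C x)"
      by (auto simp: polar_cone_def)
  qed
  with True show ?thesis
    by (auto simp: regular_normal_cone_def normal_cone_def)
qed (auto simp: regular_normal_cone_def normal_cone_def)

text \<open>The defining inequality is jointly continuous in base point and normal. Hence the graph
  is closed and taking limits of normals adds nothing.\<close>

lemma normal_cone_limit:
  assumes "closed C" "y \<longlonglongrightarrow> x" "w \<longlonglongrightarrow> v" "\<And>k. w k \<in> normal_cone C (y k)"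
  shows "v \<in> normal_cone C x"
proof -
  have "x \<in> C"
    using assms by (intro closed_sequentially[OF assms(1) _ assms(2)]) (auto simp: normal_cone_def)
  moreover have "v \<bullet> (c - x) \<le> 0" if "c \<in> C" for c
  proof (rule LIMSEQ_le_const2)
    show "(\<lambda>k. w k \<bullet> (c - y k)) \<longlonglongrightarrow> v \<bullet> (c - x)"
      by (intro tendsto_intros assms)
    show "\<exists>N. \<forall>n\<ge>N. w n \<bullet> (c - y n) \<le> 0"
      using assms(4) that by (auto simp: normal_cone_def)
  qed
  ultimately show ?thesis by (simp add: normal_cone_def)
qed

lemma limiting_normal_cone_convex:
  assumes "convex C" "closed C"
  shows "limiting_normal_cone C x = normal_cone C x"
proof
  show "limiting_normal_cone C x \<subseteq> normal_cone C x"
    using normal_cone_limit[OF assms(2)]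
    by (auto simp: limiting_normal_cone_def regular_normal_cone_convex[OF assms(1)])
  show "normal_cone C x \<subseteq> limiting_normal_cone C x"
  proof
    fix v assume v: "v \<in> normal_cone C x"
    then have "x \<in> C" by (simp add: normal_cone_def)
    then show "v \<in> limiting_normal_cone C x"
      unfolding limiting_normal_cone_def regular_normal_cone_convex[OF assms(1)] using v
      by (intro CollectI conjI exI[of _ "\<lambda>_. x"] exI[of _ "\<lambda>_. v"]) auto
  qed
qed

section \<open>Local conic structure of polyhedra\<close>

text \<open>\<open>T\<close> is cut out by the constraints active at \<open>x\<close>; the finitely
  many inactive ones stay strict on a small ball.\<close>

lemma polyhedron_local_cone:
  fixes C :: "'a::euclidean_space set"
  assumes "polyhedron C" "x \<in> C"
  obtains T \<epsilon> where "polyhedron T" "convex_cone T" "\<epsilon> > 0"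
    "\<And>w. norm w < \<epsilon> \<Longrightarrow> x + w \<in> C \<longleftrightarrow> w \<in> T" "\<And>w. x + w \<in> C \<Longrightarrow> w \<in> T"
proof -
  obtain F where F: "finite F" "C = \<Inter>F" "\<forall>h\<in>F. \<exists>a b. a \<noteq> 0 \<and> h = {x. a \<bullet> x \<le> b}"
    using assms(1) unfolding polyhedron_def by blast
  then obtain a b where ab: "\<And>h. h \<in> F \<Longrightarrow> a h \<noteq> 0 \<and> h = {x. a h \<bullet> x \<le> b h}"
    by metis
  have memC: "y \<in> C \<longleftrightarrow> (\<forall>h\<in>F. a h \<bullet> y \<le> b h)" for y
    using ab unfolding F(2) by blast
  define A where "A = {h \<in> F. a h \<bullet> x = b h}"
  define T where "T = (\<Inter>h\<in>A. {w. a h \<bullet> w \<le> 0})"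
  define O' where "O' = (\<Inter>h\<in>F-A. {y. a h \<bullet> y < b h})"
  have "open O'"
    unfolding O'_def by (intro open_INT) (use F(1) in \<open>auto intro: open_halfspace_lt\<close>)
  moreover have "x \<in> O'"
    using assms(2) by (force simp: O'_def A_def memC)
  ultimately obtain e where e: "e > 0" "ball x e \<subseteq> O'"
    by (meson open_contains_ball)
  have cone: "convex_cone T"
    unfolding T_def by (intro convex_cone_Inter) (auto intro: convex_cone_halfspace_le)
  have poly: "polyhedron T"
    unfolding T_def by (intro polyhedron_Inter) (use F(1) in \<open>auto simp: A_def polyhedron_halfspace_le\<close>)
  have fwd: "w \<in> T" if "x + w \<in> C" for w
    using that unfolding T_def memC A_def by (force simp: inner_add_right)
  have bwd: "x + w \<in> C" if "w \<in> T" "norm w < e" for w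
    unfolding memC
  proof
    fix h assume h: "h \<in> F"
    show "a h \<bullet> (x + w) \<le> b h"
    proof (cases "h \<in> A")
      case True
      with that(1) show ?thesis by (auto simp: T_def A_def inner_add_right)
    next
      case False
      have "x + w \<in> O'" using that(2) e(2) by (auto simp: dist_norm)
      with False h show ?thesis by (force simp: O'_def)
    qed
  qed
  show thesis
    using that[OF poly cone e(1)] fwd bwd by blast
qed

lemma small_scale:
  fixes w :: "'a::real_normed_vector"
  assumes "\<epsilon> > 0"
  obtains t :: real where "0 < t" "t \<le> 1" "norm (t *\<^sub>R w) < \<epsilon>"
proof
  define t where "t = min 1 (\<epsilon> / (2 * (norm w + 1)))"
  have n: "norm w + 1 > 0" by (smt (verit) norm_ge_zero)
  show "0 < t" "t \<le> 1" using assms n by (auto simp: t_def)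
  have "t * norm w \<le> \<epsilon> / (2 * (norm w + 1)) * norm w"
    unfolding t_def by (intro mult_right_mono) auto
  also have "\<dots> < \<epsilon>" using assms n by (simp add: field_simps) (smt (verit) mult_nonneg_nonneg norm_ge_zero)
  finally show "norm (t *\<^sub>R w) < \<epsilon>" using \<open>0 < t\<close> by simp
qed

text \<open>Every member of an approximating sequence is itself a radial direction and so lies in
  the active-constraint cone \<open>T\<close>; since \<open>T\<close> is closed, contingent and
  radial directions coincide.\<close>

lemma polyhedron_contingent_cone:
  fixes C :: "'a::euclidean_space set"
  assumes "polyhedron C" "x \<in> C"
  shows "polyhedron (contingent_cone C x)" "convex_cone (contingent_cone C x)"
    "w \<in> contingent_cone C x \<longleftrightarrow> (\<exists>t>0. x + t *\<^sub>R w \<in> C)"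
    "\<exists>\<epsilon>>0. \<forall>w. norm w < \<epsilon> \<longrightarrow> (x + w \<in> C \<longleftrightarrow> w \<in> contingent_cone C x)"
proof -
  obtain T \<epsilon> where T: "polyhedron T" "convex_cone T" "\<epsilon> > 0"
    "\<And>w. norm w < \<epsilon> \<Longrightarrow> x + w \<in> C \<longleftrightarrow> w \<in> T" "\<And>w. x + w \<in> C \<Longrightarrow> w \<in> T"
    using polyhedron_local_cone[OF assms] by metis
  have scale: "w \<in> T" if "t *\<^sub>R w \<in> T" "t > 0" for w and t :: real
    using convex_cone_scaleR[OF T(2) _ that(1), of "inverse t"] that(2) by simp
  have rad: "(\<exists>t>0. x + t *\<^sub>R w \<in> C) \<longleftrightarrow> w \<in> T" for w
  proof
    assume "w \<in> T"
    moreover obtain t where "0 < t" "norm (t *\<^sub>R w) < \<epsilon>"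
      using small_scale[OF T(3)] by metis
    ultimately show "\<exists>t>0. x + t *\<^sub>R w \<in> C"
      using T(4) convex_cone_scaleR[OF T(2)] less_imp_le by blast
  qed (use scale T(5) in blast)
  have "contingent_cone C x = T"
  proof
    show "T \<subseteq> contingent_cone C x"
      using rad contingent_cone_radial[OF polyhedron_imp_convex[OF assms(1)] assms(2)] by blast
    show "contingent_cone C x \<subseteq> T"
    proof
      fix w assume "w \<in> contingent_cone C x"
      then obtain t u where tu: "\<forall>k::nat. t k > 0" "u \<longlonglongrightarrow> w" "\<forall>k. x + t k *\<^sub>R u k \<in> C"
        unfolding contingent_cone_def by blast
      then have "u k \<in> T" for k
        using rad by blast
      then show "w \<in> T"
        using closed_sequentially[OF polyhedron_imp_closed[OF T(1)] _ tu(2)] by blast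
    qed
  qed
  with T rad show "polyhedron (contingent_cone C x)" "convex_cone (contingent_cone C x)"
    "w \<in> contingent_cone C x \<longleftrightarrow> (\<exists>t>0. x + t *\<^sub>R w \<in> C)"
    "\<exists>\<epsilon>>0. \<forall>w. norm w < \<epsilon> \<longrightarrow> (x + w \<in> C \<longleftrightarrow> w \<in> contingent_cone C x)"
    by auto
qed

lemma mem_orthogonal_comp_span_singleton: "w \<in> orthogonal_comp (span {v}) \<longleftrightarrow> v \<bullet> w = 0"
  by (auto simp: orthogonal_comp_def orthogonal_def span_singleton)

lemma mem_critical_cone:
  fixes C :: "'a::euclidean_space set"
  assumes "polyhedron C" "x \<in> C"
  shows "w \<in> critical_cone C x v \<longleftrightarrow> (\<exists>t>0. x + t *\<^sub>R w \<in> C) \<and> v \<bullet> w = 0"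
  by (simp add: critical_cone_def mem_orthogonal_comp_span_singleton polyhedron_contingent_cone[OF assms])

lemma polyhedron_critical_cone:
  fixes C :: "'a::euclidean_space set"
  assumes "polyhedron C" "x \<in> C"
  shows "polyhedron (critical_cone C x v)" "convex_cone (critical_cone C x v)"
proof -
  have eq: "critical_cone C x v = contingent_cone C x \<inter> {w. v \<bullet> w = 0}"
    by (auto simp: critical_cone_def mem_orthogonal_comp_span_singleton)
  show "polyhedron (critical_cone C x v)"
    unfolding eq by (intro polyhedron_Int polyhedron_hyperplane polyhedron_contingent_cone assms)
  show "convex_cone (critical_cone C x v)"
    using polyhedron_contingent_cone(2)[OF assms] unfolding eq
    by (auto simp: convex_cone_iff inner_add_right)
qed

text \<open>Cutting with a box leaves a polytope, the hull of finitely many points; every vector of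
  the cone can be scaled into the box, so these points generate the cone.\<close>

lemma polyhedral_cone_generators:
  fixes T :: "'a::euclidean_space set"
  assumes "polyhedron T" "convex_cone T"
  obtains G where "finite G" "G \<subseteq> T" "T = convex_cone hull G"
proof -
  have "polytope (T \<inter> cbox (- One) One)"
    by (intro polyhedron_Int_polytope assms polytope_interval)
  then obtain G where G: "finite G" "T \<inter> cbox (- One) One = convex hull G"
    unfolding polytope_def by blast
  then have sub: "G \<subseteq> T" using hull_subset[of G convex] by blast
  have "T \<subseteq> convex_cone hull G"
  proof
    fix x assume x: "x \<in> T"
    obtain t where t: "0 < t" "norm (t *\<^sub>R x) < 1"
      using small_scale[of 1] by (metis zero_less_one)
    have "t *\<^sub>R x \<in> cbox (- One) One"
      using Basis_le_norm[of _ "t *\<^sub>R x"] t(2) by (force simp: mem_box)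
    then have "t *\<^sub>R x \<in> convex hull G"
      using G(2) x t(1) convex_cone_scaleR[OF assms(2)] by auto
    then have "inverse t *\<^sub>R t *\<^sub>R x \<in> convex_cone hull G"
      using convex_hull_subset_convex_cone_hull[of G] t(1) convex_cone_hull_mul[of "t *\<^sub>R x" G "inverse t"]
      by auto
    then show "x \<in> convex_cone hull G" using t(1) by simp
  qed
  moreover have "convex_cone hull G \<subseteq> T"
    using sub assms(2) by (simp add: hull_minimal)
  ultimately show thesis using that G(1) sub by blast
qed

section \<open>Reduction to the critical cone\<close>

lemma normal_cone_convex_cone:
  assumes "convex_cone K"
  shows "v \<in> normal_cone K u \<longleftrightarrow> u \<in> K \<and> v \<in> polar_cone K \<and> v \<bullet> u = 0"
proof
  assume v: "v \<in> normal_cone K u"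
  then have u: "u \<in> K" and *: "\<And>y. y \<in> K \<Longrightarrow> v \<bullet> (y - u) \<le> 0"
    by (auto simp: normal_cone_def)
  have "v \<bullet> y \<le> 0" if "y \<in> K" for y
    using *[OF convex_cone_add[OF assms u that]] by simp
  moreover have "v \<bullet> u \<ge> 0"
    using *[OF convex_cone_contains_0[OF assms]] by simp
  ultimately show "u \<in> K \<and> v \<in> polar_cone K \<and> v \<bullet> u = 0"
    using u by (auto simp: polar_cone_def intro: antisym)
qed (auto simp: normal_cone_def polar_cone_def inner_diff_right)

text \<open>For \<open>y = v0 + v\<close> in the polar cone of \<open>T\<close>, the generators of \<open>T\<close> orthogonal to \<open>y\<close>
  are orthogonal to \<open>v0\<close> once \<open>v\<close> is small.\<close>

lemma polar_cone_perturbation: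
  fixes T :: "'a::euclidean_space set"
  assumes "polyhedron T" "convex_cone T" "v0 \<in> polar_cone T"
  obtains \<delta> where "\<delta> > 0"
    "\<And>v. norm v < \<delta> \<Longrightarrow> v \<in> polar_cone (T \<inter> {w. v0 \<bullet> w = 0}) \<Longrightarrow> v0 + v \<in> polar_cone T"
    "\<And>v w. norm v < \<delta> \<Longrightarrow> v0 + v \<in> polar_cone T \<Longrightarrow> w \<in> T \<Longrightarrow> (v0 + v) \<bullet> w = 0 \<Longrightarrow> v0 \<bullet> w = 0"
proof -
  obtain G where G: "finite G" "G \<subseteq> T" "T = convex_cone hull G"
    using polyhedral_cone_generators[OF assms(1,2)] .
  \<comment> \<open>Only finitely many generators have \<open>v0 \<bullet> g < 0\<close>, so one
    radius keeps all these inequalities strict.\<close>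
  define A where "A = {g \<in> G. v0 \<bullet> g < 0}"
  define N where "N = (\<Inter>g\<in>A. {v. g \<bullet> v < - (v0 \<bullet> g)})"
  have "open N"
    unfolding N_def by (intro open_INT) (use G(1) in \<open>auto simp: A_def intro: open_halfspace_lt\<close>)
  moreover have "0 \<in> N" by (auto simp: N_def A_def)
  ultimately obtain \<delta> where \<delta>: "\<delta> > 0" "ball 0 \<delta> \<subseteq> N"
    by (meson open_contains_ball)
  have strict: "(v0 + v) \<bullet> g < 0" if "norm v < \<delta>" "g \<in> G" "v0 \<bullet> g < 0" for v g
  proof -
    have "v \<in> N" using \<delta>(2) that(1) by auto
    with that(2,3) have "g \<bullet> v < - (v0 \<bullet> g)" by (auto simp: N_def A_def)
    then show ?thesis by (simp add: inner_add_left inner_commute[of v g])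
  qed
  have v0: "v0 \<bullet> g \<le> 0" if "g \<in> T" for g
    using assms(3) that by (auto simp: polar_cone_def)
  show thesis
  proof
    fix v assume v: "norm v < \<delta>" "v \<in> polar_cone (T \<inter> {w. v0 \<bullet> w = 0})"
    have "(v0 + v) \<bullet> g \<le> 0" if "g \<in> G" for g
    proof (cases "v0 \<bullet> g = 0")
      case True
      with v(2) that G(2) show ?thesis by (auto simp: polar_cone_def inner_add_left)
    next
      case False
      with v0[of g] that G(2) strict[OF v(1) that] show ?thesis by force
    qed
    then have "T \<subseteq> {w. (v0 + v) \<bullet> w \<le> 0}"
      unfolding G(3) by (intro hull_minimal convex_cone_halfspace_le) auto
    then show "v0 + v \<in> polar_cone T" by (auto simp: polar_cone_def)
  next
    fix v w assume v: "norm v < \<delta>" "v0 + v \<in> polar_cone T" "w \<in> T" "(v0 + v) \<bullet> w = 0"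
    define y where "y = v0 + v"
    \<comment> \<open>The two sign conditions make the implication stable under sums: if
      \<open>y\<close> vanishes on a sum, it vanishes on each summand. So \<open>Z\<close> is a
      convex cone and it suffices to check generators.\<close>
    define Z where "Z = {w. y \<bullet> w \<le> 0 \<and> v0 \<bullet> w \<le> 0 \<and> (y \<bullet> w = 0 \<longrightarrow> v0 \<bullet> w = 0)}"
    have "convex_cone Z"
      unfolding convex_cone_iff Z_def
      by (auto simp: inner_add_right mult_nonneg_nonpos)
    moreover have "G \<subseteq> Z"
    proof
      fix g assume g: "g \<in> G"
      then have "y \<bullet> g \<le> 0" "v0 \<bullet> g \<le> 0"
        using v(2) G(2) v0 by (auto simp: y_def polar_cone_def)
      moreover have "y \<bullet> g < 0" if "v0 \<bullet> g < 0"
        using strict[OF v(1) g that] by (simp add: y_def)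
      ultimately show "g \<in> Z" by (force simp: Z_def)
    qed
    ultimately have "T \<subseteq> Z" unfolding G(3) by (simp add: hull_minimal)
    with v(3,4) show "v0 \<bullet> w = 0" by (auto simp: Z_def y_def)
  qed (rule \<delta>(1))
qed

text \<open>If \<open>v\<close> is normal at both ends of a step along \<open>w\<close>, the two
  inequalities force \<open>v \<bullet> w = 0\<close>. This expresses the critical cone through the
  normal cone map alone, so that a local description of that map carries critical cones
  along.\<close>

lemma mem_critical_cone_normal_cone:
  fixes C :: "'a::euclidean_space set"
  assumes "polyhedron C" "v \<in> normal_cone C x"
  shows "w \<in> critical_cone C x v \<longleftrightarrow> (\<exists>t>0. \<forall>s. 0 \<le> s \<and> s \<le> t \<longrightarrow> v \<in> normal_cone C (x + s *\<^sub>R w))"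
proof -
  have x: "x \<in> C" and v: "\<And>y. y \<in> C \<Longrightarrow> v \<bullet> (y - x) \<le> 0"
    using assms(2) by (auto simp: normal_cone_def)
  show ?thesis
    unfolding mem_critical_cone[OF assms(1) x]
  proof
    assume "(\<exists>t>0. x + t *\<^sub>R w \<in> C) \<and> v \<bullet> w = 0"
    then obtain t where t: "t > 0" "x + t *\<^sub>R w \<in> C" and w: "v \<bullet> w = 0" by blast
    have "v \<in> normal_cone C (x + s *\<^sub>R w)" if "0 \<le> s \<and> s \<le> t" for s
      using convex_segment_mem[OF polyhedron_imp_convex[OF assms(1)] x t(2)] that v w
      by (simp add: normal_cone_def inner_diff_right inner_add_right)
    with t(1) show "\<exists>t>0. \<forall>s. 0 \<le> s \<and> s \<le> t \<longrightarrow> v \<in> normal_cone C (x + s *\<^sub>R w)" by blast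
  next
    assume "\<exists>t>0. \<forall>s. 0 \<le> s \<and> s \<le> t \<longrightarrow> v \<in> normal_cone C (x + s *\<^sub>R w)"
    then obtain t where t: "t > 0" "v \<in> normal_cone C (x + t *\<^sub>R w)"
      by (meson less_eq_real_def order_refl)
    then have xt: "x + t *\<^sub>R w \<in> C" and "v \<bullet> (x - (x + t *\<^sub>R w)) \<le> 0"
      using x by (auto simp: normal_cone_def)
    with v[OF xt] t(1) have "v \<bullet> w = 0"
      by (simp add: mult_le_0_iff zero_le_mult_iff)
    with t xt show "(\<exists>t>0. x + t *\<^sub>R w \<in> C) \<and> v \<bullet> w = 0" by blast
  qed
qed

text \<open>The reduction lemma for polyhedral sets: near \<open>x0\<close> the set is
  \<open>x0 + T\<close>, normals at \<open>x0 + u\<close> are vectors polar to \<open>T\<close> and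
  orthogonal to \<open>u\<close>, and for vectors near \<open>v0\<close> polarity to
  \<open>T\<close> amounts to polarity of the perturbation to \<open>K\<close>.\<close>

lemma normal_cone_reduction_local:
  fixes C :: "'a::euclidean_space set"
  assumes C: "polyhedron C" and v0: "v0 \<in> normal_cone C x0"
  shows "\<exists>\<epsilon>>0. \<forall>u v. norm u < \<epsilon> \<longrightarrow> norm v < \<epsilon> \<longrightarrow>
      (v0 + v \<in> normal_cone C (x0 + u) \<longleftrightarrow> v \<in> normal_cone (critical_cone C x0 v0) u)"
proof -
  define T where "T = contingent_cone C x0"
  define K where "K = critical_cone C x0 v0"
  have x0: "x0 \<in> C" using v0 by (simp add: normal_cone_def)
  note T = polyhedron_contingent_cone[OF C x0, folded T_def]
  have K: "K = T \<inter> {w. v0 \<bullet> w = 0}"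
    by (auto simp: K_def T_def critical_cone_def mem_orthogonal_comp_span_singleton)
  have Kcone: "convex_cone K" unfolding K_def by (rule polyhedron_critical_cone(2)[OF C x0])
  have CT: "y - x0 \<in> T" if "y \<in> C" for y
    using that by (auto simp: T(3) intro: exI[of _ 1])
  have v0T: "v0 \<in> polar_cone T"
    using v0 unfolding T_def
    by (simp add: regular_normal_cone_convex[OF polyhedron_imp_convex[OF C], symmetric]
        regular_normal_cone_def x0)
  obtain e where e: "e > 0" "\<And>w. norm w < e \<Longrightarrow> x0 + w \<in> C \<longleftrightarrow> w \<in> T"
    using T(4) by blast
  obtain \<delta> where \<delta>: "\<delta> > 0"
    "\<And>v. norm v < \<delta> \<Longrightarrow> v \<in> polar_cone K \<Longrightarrow> v0 + v \<in> polar_cone T"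
    "\<And>v w. norm v < \<delta> \<Longrightarrow> v0 + v \<in> polar_cone T \<Longrightarrow> w \<in> T \<Longrightarrow> (v0 + v) \<bullet> w = 0 \<Longrightarrow> v0 \<bullet> w = 0"
    using polar_cone_perturbation[OF T(1,2) v0T] unfolding K by metis
  have "v0 + v \<in> normal_cone C (x0 + u) \<longleftrightarrow> v \<in> normal_cone K u"
    if u: "norm u < e" and v: "norm v < \<delta>" for u v
  proof
    assume "v \<in> normal_cone K u"
    then have *: "u \<in> K" "v \<in> polar_cone K" "v \<bullet> u = 0"
      using normal_cone_convex_cone[OF Kcone] by auto
    have "v0 + v \<in> polar_cone T" by (rule \<delta>(2)[OF v *(2)])
    then have "(v0 + v) \<bullet> (y - x0) \<le> 0" if "y \<in> C" for y
      using CT[OF that] by (auto simp: polar_cone_def)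
    moreover have "(v0 + v) \<bullet> u = 0" "x0 + u \<in> C"
      using * e(2)[OF u] by (auto simp: K inner_add_left)
    ultimately show "v0 + v \<in> normal_cone C (x0 + u)"
      by (auto simp: normal_cone_def inner_diff_right inner_add_right)
  next
    assume n: "v0 + v \<in> normal_cone C (x0 + u)"
    define y where "y = v0 + v"
    have xu: "x0 + u \<in> C" and y: "\<And>c. c \<in> C \<Longrightarrow> y \<bullet> (c - (x0 + u)) \<le> 0"
      using n by (auto simp: normal_cone_def y_def)
    have uT: "u \<in> T" using CT[OF xu] by simp
    \<comment> \<open>A short step from \<open>u\<close> along \<open>w\<close> stays in
      \<open>T\<close> and within the radius where \<open>T\<close> describes \<open>C\<close>, so
      normality at \<open>x0 + u\<close> tests every \<open>w\<close> in \<open>T\<close>.\<close>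
    have yT: "y \<bullet> w \<le> 0" if w: "w \<in> T" for w
    proof -
      obtain t where t: "0 < t" "norm (t *\<^sub>R w) < e - norm u"
        using small_scale[of "e - norm u" w] u by auto
      have "norm (u + t *\<^sub>R w) < e" using t(2) norm_triangle_ineq[of u "t *\<^sub>R w"] by linarith
      moreover have "u + t *\<^sub>R w \<in> T"
        using convex_cone_add[OF T(2) uT convex_cone_scaleR[OF T(2) _ w]] t(1) by simp
      ultimately have "x0 + (u + t *\<^sub>R w) \<in> C" using e(2) by blast
      from y[OF this] t(1) show ?thesis by (simp add: mult_le_0_iff)
    qed
    have yu: "y \<bullet> u = 0"
      using yT[OF uT] y[OF x0] by (simp add: inner_diff_right inner_add_right)
    have v0u: "v0 \<bullet> u = 0"
      using \<delta>(3)[OF v _ uT] yT yu by (auto simp: y_def polar_cone_def)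
    have "v \<in> polar_cone K"
      using yT by (force simp: polar_cone_def K y_def inner_add_left)
    moreover have "u \<in> K" using uT v0u by (simp add: K)
    moreover have "v \<bullet> u = 0" using yu v0u by (simp add: y_def inner_add_left)
    ultimately show "v \<in> normal_cone K u"
      using normal_cone_convex_cone[OF Kcone] by blast
  qed
  then show ?thesis
    unfolding K_def using e(1) \<delta>(1) by (intro exI[of _ "min e \<delta>"]) auto
qed

text \<open>By its characterization through the normal cone map along short segments, the critical
  cone depends only on that map near the point; the local reduction therefore identifies critical
  cones as well.\<close>

lemma normal_cone_reduction:
  fixes C :: "'a::euclidean_space set"
  assumes C: "polyhedron C" and v0: "v0 \<in> normal_cone C x0"
  obtains \<epsilon> where "\<epsilon> > 0"
    "\<And>u v. norm u < \<epsilon> \<Longrightarrow> norm v < \<epsilon> \<Longrightarrow>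
      v0 + v \<in> normal_cone C (x0 + u) \<longleftrightarrow> v \<in> normal_cone (critical_cone C x0 v0) u"
    "\<And>u v. norm u < \<epsilon> \<Longrightarrow> norm v < \<epsilon> \<Longrightarrow> v \<in> normal_cone (critical_cone C x0 v0) u \<Longrightarrow>
      critical_cone C (x0 + u) (v0 + v) = critical_cone (critical_cone C x0 v0) u v"
proof -
  define K where "K = critical_cone C x0 v0"
  have "x0 \<in> C" using v0 by (simp add: normal_cone_def)
  then have K: "polyhedron K" unfolding K_def using C by (rule polyhedron_critical_cone(1)[rotated])
  obtain \<epsilon> where \<epsilon>: "\<epsilon> > 0" "\<And>u v. norm u < \<epsilon> \<Longrightarrow> norm v < \<epsilon> \<Longrightarrow>
      v0 + v \<in> normal_cone C (x0 + u) \<longleftrightarrow> v \<in> normal_cone K u"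
    using normal_cone_reduction_local[OF assms] unfolding K_def by blast
  have "critical_cone C (x0 + u) (v0 + v) = critical_cone K u v"
    if u: "norm u < \<epsilon>" and v: "norm v < \<epsilon>" and n: "v \<in> normal_cone K u" for u v
  proof (rule set_eqI)
    fix w :: 'a
    have n': "v0 + v \<in> normal_cone C (x0 + u)" using \<epsilon>(2)[OF u v] n by blast
    obtain r where r: "0 < r" "norm (r *\<^sub>R w) < \<epsilon> - norm u"
      using small_scale[of "\<epsilon> - norm u" w] u by auto
    have eq: "v0 + v \<in> normal_cone C (x0 + u + s *\<^sub>R w) \<longleftrightarrow> v \<in> normal_cone K (u + s *\<^sub>R w)"
      if "0 \<le> s" "s \<le> r" for s :: real
    proof -
      have "norm (s *\<^sub>R w) \<le> norm (r *\<^sub>R w)" using that by (simp add: mult_right_mono)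
      then have "norm (u + s *\<^sub>R w) < \<epsilon>"
        using r(2) norm_triangle_ineq[of u "s *\<^sub>R w"] by linarith
      from \<epsilon>(2)[OF this v] show ?thesis by (simp add: add.assoc)
    qed
    \<comment> \<open>The step length may be capped at \<open>r\<close>, up to which the whole
      segment stays inside the reduction neighbourhood.\<close>
    have shrink: "(\<exists>t>0. \<forall>s. 0 \<le> s \<and> s \<le> t \<longrightarrow> P s) \<longleftrightarrow> (\<exists>t>0. t \<le> r \<and> (\<forall>s. 0 \<le> s \<and> s \<le> t \<longrightarrow> P s))"
      for P :: "real \<Rightarrow> bool"
    proof
      assume "\<exists>t>0. \<forall>s. 0 \<le> s \<and> s \<le> t \<longrightarrow> P s"
      then obtain t where "t > 0" "\<forall>s. 0 \<le> s \<and> s \<le> t \<longrightarrow> P s" by blast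
      with r(1) show "\<exists>t>0. t \<le> r \<and> (\<forall>s. 0 \<le> s \<and> s \<le> t \<longrightarrow> P s)"
        by (intro exI[of _ "min t r"]) auto
    qed blast
    show "w \<in> critical_cone C (x0 + u) (v0 + v) \<longleftrightarrow> w \<in> critical_cone K u v"
      unfolding mem_critical_cone_normal_cone[OF C n'] mem_critical_cone_normal_cone[OF K n] shrink
      using eq by (meson order_trans)
  qed
  with \<epsilon> show thesis using that unfolding K_def by blast
qed

section \<open>Critical cones and differences of faces\<close>

lemma mem_closed_faces:
  "F \<in> closed_faces K \<longleftrightarrow> (\<exists>v\<in>polar_cone K. F = K \<inter> {x. v \<bullet> x = 0})"
proof -
  have "K \<inter> orthogonal_comp (span {v}) = K \<inter> {x. v \<bullet> x = 0}" for v :: 'a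
    by (auto simp: mem_orthogonal_comp_span_singleton)
  then show ?thesis by (auto simp: closed_faces_def)
qed

text \<open>Faces of this form are exposed by supporting hyperplanes, and a polyhedron has finitely
  many faces. All uniform constants below rest on this.\<close>

lemma finite_closed_faces:
  assumes "polyhedron K"
  shows "finite (closed_faces K)"
proof (rule finite_subset)
  show "finite {F. F face_of K}" by (rule finite_polyhedron_faces[OF assms])
  show "closed_faces K \<subseteq> {F. F face_of K}"
    using face_of_Int_supporting_hyperplane_le[OF polyhedron_imp_convex[OF assms], where b = 0]
    by (auto simp: mem_closed_faces polar_cone_def)
qed

lemma polyhedral_cone_closed_face:
  assumes "polyhedron K" "convex_cone K" "F \<in> closed_faces K"
  shows "polyhedron F" "convex_cone F" "F \<subseteq> K"
proof -
  obtain v where F: "F = K \<inter> {x. v \<bullet> x = 0}"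
    using assms(3) unfolding mem_closed_faces by blast
  show "polyhedron F"
    unfolding F by (intro polyhedron_Int assms polyhedron_hyperplane)
  show "convex_cone F"
    using assms(2) unfolding F by (auto simp: convex_cone_iff inner_add_right)
  show "F \<subseteq> K" using F by blast
qed

text \<open>Shared by both directions of the correspondence below. By \<open>dom\<close>,
  subtracting a small multiple of \<open>f\<close> from \<open>u\<close> stays in \<open>K\<close>,
  and adding vectors of \<open>K\<close> always does; conversely \<open>w\<close> is the difference
  of \<open>(u + t w) / t\<close> and \<open>u / t\<close>.\<close>

lemma difference_set_eq_critical_cone:
  fixes K :: "'a::euclidean_space set"
  assumes K: "polyhedron K" "convex_cone K" and v: "v \<in> polar_cone K"
    and coneF: "convex_cone F" and u: "u \<in> F" and F: "F \<subseteq> K \<inter> {x. v \<bullet> x = 0}"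
    and dom: "\<And>f. f \<in> F \<Longrightarrow> \<exists>t>0. u - t *\<^sub>R f \<in> K"
  shows "difference_set (K \<inter> {x. v \<bullet> x = 0}) F = critical_cone K u v"
proof
  have uK: "u \<in> K" using u F by blast
  show "difference_set (K \<inter> {x. v \<bullet> x = 0}) F \<subseteq> critical_cone K u v"
  proof
    fix w assume "w \<in> difference_set (K \<inter> {x. v \<bullet> x = 0}) F"
    then obtain k f where w: "w = k - f" "k \<in> K" "v \<bullet> k = 0" "f \<in> F"
      by (auto simp: difference_set_def)
    obtain t where t: "t > 0" "u - t *\<^sub>R f \<in> K" using dom[OF w(4)] by blast
    have "(u - t *\<^sub>R f) + t *\<^sub>R k \<in> K"
      using t w(2) by (intro convex_cone_add[OF K(2)] convex_cone_scaleR[OF K(2)]) auto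
    then have "u + t *\<^sub>R w \<in> K" by (simp add: w(1) algebra_simps)
    moreover have "v \<bullet> w = 0" using w F by (auto simp: inner_diff_right)
    ultimately show "w \<in> critical_cone K u v"
      using t(1) mem_critical_cone[OF K(1) uK] by blast
  qed
  show "critical_cone K u v \<subseteq> difference_set (K \<inter> {x. v \<bullet> x = 0}) F"
  proof
    fix w assume "w \<in> critical_cone K u v"
    then obtain t where t: "t > 0" "u + t *\<^sub>R w \<in> K" and vw: "v \<bullet> w = 0"
      using mem_critical_cone[OF K(1) uK] by blast
    define s where "s = inverse t"
    have "w = s *\<^sub>R (u + t *\<^sub>R w) - s *\<^sub>R u"
      using t(1) by (simp add: s_def algebra_simps)
    moreover have "s *\<^sub>R (u + t *\<^sub>R w) \<in> K" "s *\<^sub>R u \<in> F"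
      using t u by (auto intro!: convex_cone_scaleR[OF K(2)] convex_cone_scaleR[OF coneF] simp: s_def)
    moreover have "v \<bullet> (s *\<^sub>R (u + t *\<^sub>R w)) = 0"
      using u F vw by (auto simp: inner_add_right)
    ultimately show "w \<in> difference_set (K \<inter> {x. v \<bullet> x = 0}) F"
      unfolding difference_set_def by blast
  qed
qed

text \<open>Since 0 lies in \<open>K\<close>, all offsets are nonnegative; since \<open>K\<close> is
  invariant under scaling, no point can have positive value against a normal, so the offsets may be
  replaced by 0.\<close>

lemma polyhedral_cone_halfspaces:
  fixes K :: "'a::euclidean_space set"
  assumes "polyhedron K" "convex_cone K"
  obtains F :: "'a set set" and a where "finite F" "\<And>x. x \<in> K \<longleftrightarrow> (\<forall>h\<in>F. a h \<bullet> x \<le> 0)"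
proof -
  obtain F where F: "finite F" "K = \<Inter>F" "\<forall>h\<in>F. \<exists>a b. a \<noteq> 0 \<and> h = {x. a \<bullet> x \<le> b}"
    using assms(1) unfolding polyhedron_def by blast
  then obtain a b where ab: "\<And>h. h \<in> F \<Longrightarrow> a h \<noteq> 0 \<and> h = {x. a h \<bullet> x \<le> b h}"
    by metis
  have memK: "x \<in> K \<longleftrightarrow> (\<forall>h\<in>F. a h \<bullet> x \<le> b h)" for x
    using ab unfolding F(2) by blast
  have b: "0 \<le> b h" if "h \<in> F" for h
    using convex_cone_contains_0[OF assms(2)] that by (auto simp: memK)
  have "a h \<bullet> x \<le> 0" if x: "x \<in> K" and h: "h \<in> F" for x h
  proof (rule ccontr)
    assume "\<not> a h \<bullet> x \<le> 0"
    then have pos: "a h \<bullet> x > 0" by simp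
    \<comment> \<open>Scaled so that \<open>a h\<close> takes the value \<open>b h + 1\<close>,
      which violates the constraint.\<close>
    define c where "c = (b h + 1) / (a h \<bullet> x)"
    have "c *\<^sub>R x \<in> K"
      using convex_cone_scaleR[OF assms(2) _ x, of c] b[OF h] pos by (simp add: c_def)
    then have "a h \<bullet> (c *\<^sub>R x) \<le> b h" using h by (auto simp: memK)
    then show False using pos by (simp add: c_def)
  qed
  then have "x \<in> K \<longleftrightarrow> (\<forall>h\<in>F. a h \<bullet> x \<le> 0)" for x
    using memK b by (meson order_trans)
  then show thesis using that F(1) by blast
qed

text \<open>\<open>F2\<close> is the smallest closed face containing \<open>u\<close>: it is cut out by the sum of the
  constraint normals that are active at \<open>u\<close>.\<close>

lemma critical_cone_eq_difference_set:
  fixes K :: "'a::euclidean_space set"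
  assumes K: "polyhedron K" "convex_cone K" and n: "v \<in> normal_cone K u"
  shows "\<exists>F1\<in>closed_faces K. \<exists>F2\<in>closed_faces K. F2 \<subseteq> F1 \<and> difference_set F1 F2 = critical_cone K u v"
proof -
  have u: "u \<in> K" and v: "v \<in> polar_cone K" and vu: "v \<bullet> u = 0"
    using n normal_cone_convex_cone[OF K(2)] by auto
  obtain H :: "'a set set" and a where H: "finite H" "\<And>x. x \<in> K \<longleftrightarrow> (\<forall>h\<in>H. a h \<bullet> x \<le> 0)"
    using polyhedral_cone_halfspaces[OF K] by blast
  define A where "A = {h\<in>H. a h \<bullet> u = 0}"
  have A: "finite A" using H(1) by (simp add: A_def)
  define w where "w = (\<Sum>h\<in>A. a h)"
  define F1 where "F1 = K \<inter> {x. v \<bullet> x = 0}"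
  define F2 where "F2 = K \<inter> {x. w \<bullet> x = 0}"
  have w: "w \<in> polar_cone K"
    using H(2) by (auto simp: polar_cone_def w_def inner_sum_left A_def intro!: sum_nonpos)
  have F1: "F1 \<in> closed_faces K" and F2: "F2 \<in> closed_faces K"
    using v w by (auto simp: mem_closed_faces F1_def F2_def)
  have uF2: "u \<in> F2"
    using u by (simp add: F2_def w_def inner_sum_left A_def)
  \<comment> \<open>A vanishing sum of nonpositive terms vanishes termwise, so \<open>f\<close>
    keeps every active constraint active; the inactive ones tolerate a small step.\<close>
  have dom: "\<exists>t>0. u - t *\<^sub>R f \<in> K" if f: "f \<in> F2" for f
  proof -
    have fK: "f \<in> K" and "(\<Sum>h\<in>A. a h \<bullet> f) = 0"
      using f by (auto simp: F2_def w_def inner_sum_left)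
    then have fA: "a h \<bullet> f = 0" if "h \<in> A" for h
      using that A H(2) sum_nonneg_eq_0_iff[of A "\<lambda>h. - (a h \<bullet> f)"]
    by (auto simp: A_def sum_negf)
    define N where "N = (\<Inter>h\<in>H-A. {y. a h \<bullet> y < 0})"
    have "open N"
      unfolding N_def by (intro open_INT) (use H(1) in \<open>auto intro: open_halfspace_lt\<close>)
    moreover have "u \<in> N" using u H(2) by (force simp: N_def A_def)
    ultimately obtain e where e: "e > 0" "ball u e \<subseteq> N"
      by (meson open_contains_ball)
    obtain t where t: "0 < t" "norm (t *\<^sub>R f) < e"
      using small_scale[OF e(1)] by metis
    have "u - t *\<^sub>R f \<in> N" using e(2) t(2) by (auto simp: dist_norm)
    then have "a h \<bullet> (u - t *\<^sub>R f) \<le> 0" if "h \<in> H" for h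
      using fA[of h] that by (cases "h \<in> A") (force simp: N_def A_def inner_diff_right)+
    then show ?thesis using t(1) H(2) by blast
  qed
  \<comment> \<open>Feasibility of \<open>u - t f\<close> and \<open>v \<bullet> u = 0\<close> give
    \<open>v \<bullet> f \<ge> 0\<close>; polarity gives the opposite sign.\<close>
  have F21: "F2 \<subseteq> F1"
  proof
    fix f assume f: "f \<in> F2"
    then obtain t where t: "t > 0" "u - t *\<^sub>R f \<in> K" using dom by blast
    then have "v \<bullet> (u - t *\<^sub>R f) \<le> 0" "v \<bullet> f \<le> 0"
      using v f by (auto simp: polar_cone_def F2_def)
    then have "v \<bullet> f = 0"
      using t(1) vu by (simp add: inner_diff_right zero_le_mult_iff)
    with f show "f \<in> F1" by (simp add: F1_def F2_def)
  qed
  have "difference_set F1 F2 = critical_cone K u v"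
    unfolding F1_def
    by (rule difference_set_eq_critical_cone[OF K v _ uF2 F21[unfolded F1_def] dom])
       (rule polyhedral_cone_closed_face(2)[OF K F2])
  with F1 F2 F21 show ?thesis by blast
qed

text \<open>The sum \<open>u\<close> of generators of \<open>F2\<close> plays the part of a relative
  interior point: each generator can be subtracted from it within \<open>F2\<close>, and hence a
  positive multiple of each vector of \<open>F2\<close>. For \<open>v\<close> one takes a vector
  exposing \<open>F1\<close>.\<close>

lemma difference_set_closed_faces:
  fixes K :: "'a::euclidean_space set"
  assumes K: "polyhedron K" "convex_cone K"
    and F1: "F1 \<in> closed_faces K" and F2: "F2 \<in> closed_faces K" and F21: "F2 \<subseteq> F1"
  obtains u v where "v \<in> normal_cone K u" "difference_set F1 F2 = critical_cone K u v"
proof -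
  obtain v where v: "v \<in> polar_cone K" "F1 = K \<inter> {x. v \<bullet> x = 0}"
    using F1 unfolding mem_closed_faces by blast
  note P = polyhedral_cone_closed_face[OF K F2]
  obtain G where G: "finite G" "G \<subseteq> F2" "F2 = convex_cone hull G"
    using polyhedral_cone_generators[OF P(1,2)] .
  define u where "u = \<Sum>G"
  have sum_mem: "\<Sum>S \<in> F2" if "S \<subseteq> G" for S
    using finite_subset[OF that G(1)] that
    by (induction S rule: finite_induct)
       (use G(2) P(2) in \<open>auto intro: convex_cone_contains_0 convex_cone_add\<close>)
  have u: "u \<in> F2" unfolding u_def by (rule sum_mem) simp
  define Z where "Z = {f. \<exists>t>0. u - t *\<^sub>R f \<in> F2}"
  have "F2 \<subseteq> Z"
    unfolding G(3)
  proof (rule hull_minimal)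
    show "G \<subseteq> Z"
    proof
      fix g assume g: "g \<in> G"
      have "u - 1 *\<^sub>R g = \<Sum>(G - {g})" using G(1) g by (simp add: u_def sum_diff1)
      also have "\<dots> \<in> F2" by (rule sum_mem) auto
      finally show "g \<in> Z" unfolding Z_def using zero_less_one by blast
    qed
    show "convex_cone Z"
      unfolding convex_cone_iff
    proof (intro conjI ballI allI impI)
      show "0 \<in> Z" using u by (auto simp: Z_def intro: exI[of _ 1])
    next
      fix f f' assume "f \<in> Z" "f' \<in> Z"
      then obtain t t' where t: "t > 0" "u - t *\<^sub>R f \<in> F2" "t' > 0" "u - t' *\<^sub>R f' \<in> F2"
        by (auto simp: Z_def)
      define r where "r = t + t'"
      have r: "r > 0" using t by (simp add: r_def)
      \<comment> \<open>These convex weights make the multiples of \<open>f\<close> and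
        \<open>f'\<close> subtracted equal, namely \<open>t * t' / r\<close>.\<close>
      have "(t' / r) *\<^sub>R (u - t *\<^sub>R f) + (t / r) *\<^sub>R (u - t' *\<^sub>R f') \<in> F2"
        using t r by (intro convex_cone_add[OF P(2)] convex_cone_scaleR[OF P(2)]) auto
      moreover have "(t' / r) *\<^sub>R (u - t *\<^sub>R f) + (t / r) *\<^sub>R (u - t' *\<^sub>R f')
          = (t' / r + t / r) *\<^sub>R u - (t * t' / r) *\<^sub>R (f + f')"
        by (simp add: algebra_simps)
      moreover have "t' / r + t / r = 1"
        using r by (simp add: r_def flip: add_divide_distrib)
      ultimately have "u - (t * t' / r) *\<^sub>R (f + f') \<in> F2" by simp
      moreover have "t * t' / r > 0" using t r by simp
      ultimately show "f + f' \<in> Z" unfolding Z_def by blast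
    next
      fix f and c :: real assume "f \<in> Z" "0 \<le> c"
      then obtain t where t: "t > 0" "u - t *\<^sub>R f \<in> F2" by (auto simp: Z_def)
      show "c *\<^sub>R f \<in> Z"
      proof (cases "c = 0")
        case True
        with u show ?thesis by (auto simp: Z_def intro: exI[of _ 1])
      next
        case False
        with t \<open>0 \<le> c\<close> show ?thesis by (auto simp: Z_def intro!: exI[of _ "t / c"])
      qed
    qed
  qed
  then have dom: "\<exists>t>0. u - t *\<^sub>R f \<in> K" if "f \<in> F2" for f
    using that P(3) unfolding Z_def by blast
  have "difference_set F1 F2 = critical_cone K u v"
    unfolding v(2)
    by (rule difference_set_eq_critical_cone[OF K v(1) P(2) u F21[unfolded v(2)] dom])
  moreover have "v \<in> normal_cone K u"
    using u F21 v normal_cone_convex_cone[OF K(2)] by auto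
  ultimately show thesis using that by blast
qed

section \<open>Variational inequalities over polyhedral cones\<close>

text \<open>The projection of \<open>P\<close> cut by a box is the hull of finitely many points;
  convex combinations of chosen preimages give bounded preimages over the box, and homogeneity turns
  the bound into a linear one.\<close>

lemma cone_selection_bound:
  fixes P :: "('a::euclidean_space \<times> 'b::euclidean_space) set"
  assumes P: "convex_cone P" and D: "polyhedron (fst ` P)"
  shows "\<exists>\<kappa>\<ge>0. \<forall>d w. (d, w) \<in> P \<longrightarrow> (\<exists>w'. (d, w') \<in> P \<and> norm w' \<le> \<kappa> * norm d)"
proof -
  have "polytope (fst ` P \<inter> cbox (- One) One)"
    by (intro polyhedron_Int_polytope D polytope_interval)
  then obtain V where V: "finite V" "fst ` P \<inter> cbox (- One) One = convex hull V"
    unfolding polytope_def by blast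
  then have "V \<subseteq> fst ` P" using hull_subset[of V convex] by blast
  then have "\<exists>w. (e, w) \<in> P" if "e \<in> V" for e using that by force
  then obtain f where f: "\<And>e. e \<in> V \<Longrightarrow> (e, f e) \<in> P" by metis
  define \<kappa> where "\<kappa> = (\<Sum>e\<in>V. norm (f e))"
  define Z where "Z = fst ` (P \<inter> UNIV \<times> cball 0 \<kappa>)"
  have "convex hull V \<subseteq> Z"
  proof (rule hull_minimal)
    show "convex Z"
      unfolding Z_def using P
      by (intro convex_linear_image linear_fst convex_Int convex_Times) (auto simp: convex_cone_def)
    show "V \<subseteq> Z"
    proof
      fix e assume e: "e \<in> V"
      have "norm (f e) \<le> \<kappa>" unfolding \<kappa>_def using e V(1) by (intro member_le_sum) auto
      with f[OF e] show "e \<in> Z" unfolding Z_def by force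
    qed
  qed
  then have Z: "\<exists>w. (d, w) \<in> P \<and> norm w \<le> \<kappa>" if "d \<in> fst ` P" "d \<in> cbox (- One) One" for d
    using V(2) that unfolding Z_def by fastforce
  show ?thesis
  proof (intro exI[of _ \<kappa>] conjI allI impI)
    show "\<kappa> \<ge> 0" by (simp add: \<kappa>_def sum_nonneg)
    fix d w assume dw: "(d, w) \<in> P"
    show "\<exists>w'. (d, w') \<in> P \<and> norm w' \<le> \<kappa> * norm d"
    proof (cases "d = 0")
      case True
      with convex_cone_contains_0[OF P] show ?thesis by (intro exI[of _ 0]) (simp add: zero_prod_def)
    next
      case False
      define e where "e = d /\<^sub>R norm d"
      have "(e, w /\<^sub>R norm d) \<in> P"
        using convex_cone_scaleR[OF P _ dw, of "inverse (norm d)"] by (simp add: e_def scaleR_prod_def)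
      then have "e \<in> fst ` P" by force
      moreover have "norm e = 1" using False by (simp add: e_def)
      then have "e \<in> cbox (- One) One"
        using Basis_le_norm[of _ e] by (force simp: mem_box)
      ultimately obtain w' where w': "(e, w') \<in> P" "norm w' \<le> \<kappa>" using Z by blast
      have "(d, norm d *\<^sub>R w') \<in> P"
        using convex_cone_scaleR[OF P _ w'(1), of "norm d"] False by (simp add: e_def scaleR_prod_def)
      moreover have "norm (norm d *\<^sub>R w') \<le> \<kappa> * norm d"
        using mult_left_mono[OF w'(2) norm_ge_zero[of d]] by (simp add: mult.commute)
      ultimately show ?thesis by blast
    qed
  qed
qed

lemma polyhedral_cone_polar_cone:
  fixes L :: "'a::euclidean_space set"
  assumes "polyhedron L" "convex_cone L"
  shows "polyhedron (polar_cone L)"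
proof -
  obtain G where G: "finite G" "G \<subseteq> L" "L = convex_cone hull G"
    using polyhedral_cone_generators[OF assms] .
  have "v \<in> polar_cone L" if "\<And>g. g \<in> G \<Longrightarrow> g \<bullet> v \<le> 0" for v
  proof -
    have "L \<subseteq> {w. v \<bullet> w \<le> 0}"
      unfolding G(3) using that by (intro hull_minimal convex_cone_halfspace_le) (auto simp: inner_commute)
    then show ?thesis by (auto simp: polar_cone_def)
  qed
  then have "polar_cone L = (\<Inter>g\<in>G. {v. g \<bullet> v \<le> 0})"
    using G(2) by (auto simp: polar_cone_def inner_commute)
  then show ?thesis
    using G(1) by (auto simp: polyhedron_halfspace_le)
qed

lemma convex_cone_polar_cone: "convex_cone (polar_cone L)"
  by (auto simp: convex_cone_iff polar_cone_def inner_add_left mult_nonneg_nonpos intro: add_nonpos_nonpos)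

text \<open>The bipolar theorem: if \<open>z\<close> were outside, the negative of a separating
  normal would lie in the polar cone and contradict the assumption on \<open>z\<close>.\<close>

lemma polar_polar_cone:
  fixes T :: "'a::euclidean_space set"
  assumes "closed T" "convex_cone T" "z \<in> polar_cone (polar_cone T)"
  shows "z \<in> T"
proof (rule ccontr)
  assume "z \<notin> T"
  then obtain a b where ab: "a \<bullet> z < b" "\<And>x. x \<in> T \<Longrightarrow> b < a \<bullet> x"
    using separating_hyperplane_closed_point[of T z] assms(1,2) unfolding convex_cone_def by metis
  have b: "b < 0" using ab(2)[OF convex_cone_contains_0[OF assms(2)]] by simp
  have "a \<bullet> x \<ge> 0" if x: "x \<in> T" for x
  proof (rule ccontr)
    assume "\<not> a \<bullet> x \<ge> 0"
    \<comment> \<open>A multiple of \<open>x\<close> on which \<open>a\<close> takes exactly the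
      value \<open>b\<close>, against strict separation.\<close>
    then have "(b / (a \<bullet> x)) *\<^sub>R x \<in> T" and "a \<bullet> x \<noteq> 0"
      using b by (auto intro!: convex_cone_scaleR[OF assms(2) _ x] simp: divide_nonpos_neg)
    then show False using ab(2)[of "(b / (a \<bullet> x)) *\<^sub>R x"] by simp
  qed
  then have "- a \<in> polar_cone T" by (simp add: polar_cone_def)
  with assms(3) have "z \<bullet> (- a) \<le> 0" unfolding polar_cone_def by blast
  with ab(1) b show False by (simp add: inner_commute)
qed

text \<open>The solution graph is the union, over the closed faces \<open>F\<close> of \<open>L\<close>, of the convex cones
  on which \<open>w \<in> F\<close> and the normal vector lies in the polar cone of \<open>L\<close> and is orthogonal to \<open>F\<close>.\<close>

lemma conic_vi_solution_bound:
  fixes L :: "'a::euclidean_space set"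
  assumes L: "polyhedron L" "convex_cone L" and A: "linear A"
  shows "\<exists>\<kappa>\<ge>0. \<forall>d w. - d - A w \<in> normal_cone L w \<longrightarrow>
      (\<exists>w'. - d - A w' \<in> normal_cone L w' \<and> norm w' \<le> \<kappa> * norm d)"
proof -
  define V where "V F = polar_cone L \<inter> uminus ` polar_cone F" for F
  define P where "P F = {(d, w). w \<in> F \<and> - d - A w \<in> V F}" for F
  have "\<exists>\<kappa>\<ge>0. \<forall>d w. (d, w) \<in> P F \<longrightarrow> (\<exists>w'. (d, w') \<in> P F \<and> norm w' \<le> \<kappa> * norm d)"
    if F: "F \<in> closed_faces L" for F
  proof (rule cone_selection_bound)
    note F' = polyhedral_cone_closed_face[OF L F]
    have V: "polyhedron (V F)" "convex_cone (V F)"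
      unfolding V_def
      using polyhedral_cone_polar_cone[OF L] polyhedral_cone_polar_cone[OF F'(1,2)]
        convex_cone_polar_cone[of L] convex_cone_negations[OF convex_cone_polar_cone[of F]]
      by (auto intro: polyhedron_negations simp: convex_cone_iff)
    show "convex_cone (P F)"
      unfolding convex_cone_iff
    proof (intro conjI ballI allI impI)
      show "0 \<in> P F"
        using convex_cone_contains_0[OF F'(2)] convex_cone_contains_0[OF V(2)] linear_0[OF A]
        by (simp add: P_def zero_prod_def)
    next
      fix p q assume pq: "p \<in> P F" "q \<in> P F"
      have "- (fst p + fst q) - A (snd p + snd q) = (- fst p - A (snd p)) + (- fst q - A (snd q))"
        by (simp add: linear_add[OF A])
      also have "\<dots> \<in> V F" using pq by (intro convex_cone_add[OF V(2)]) (auto simp: P_def)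
      finally show "p + q \<in> P F"
        using pq convex_cone_add[OF F'(2)] by (auto simp: P_def)
    next
      fix p and c :: real assume pc: "p \<in> P F" "0 \<le> c"
      have "- (c *\<^sub>R fst p) - A (c *\<^sub>R snd p) = c *\<^sub>R (- fst p - A (snd p))"
        by (simp add: linear_scale[OF A] algebra_simps)
      also have "\<dots> \<in> V F" using pc by (intro convex_cone_scaleR[OF V(2)]) (auto simp: P_def)
      finally show "c *\<^sub>R p \<in> P F"
        using pc convex_cone_scaleR[OF F'(2)] by (auto simp: P_def)
    qed
    obtain G1 where G1: "finite G1" "F = convex_cone hull G1"
      using polyhedral_cone_generators[OF F'(1,2)] by metis
    obtain G2 where G2: "finite G2" "V F = convex_cone hull G2"
      using polyhedral_cone_generators[OF V] by metis
    define f where "f w = - A w" for w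
    have f: "linear f" unfolding f_def using linear_compose_neg[OF A] .
    \<comment> \<open>The right-hand sides reached by this piece form the sum of the images of
      \<open>F\<close> under \<open>- A\<close> and of \<open>V F\<close> under negation. Both are
      finitely generated, so the sum is polyhedral, as the selection bound requires.\<close>
    have "fst ` P F = (\<Union>x\<in>f ` F. \<Union>y\<in>uminus ` V F. {x + y})"
    proof safe
      fix d w assume "(d, w) \<in> P F"
      then have "d = f w + - (- d - A w)" "w \<in> F" "- d - A w \<in> V F"
        by (auto simp: P_def f_def)
      then show "fst (d, w) \<in> (\<Union>x\<in>f ` F. \<Union>y\<in>uminus ` V F. {x + y})"
        by (metis (no_types, lifting) UN_I fst_conv imageI singletonI)
    next
      fix w v assume "w \<in> F" "v \<in> V F"
      then have "(f w + - v, w) \<in> P F" by (simp add: P_def f_def)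
      then show "f w + - v \<in> fst ` P F" by force
    qed
    also have "\<dots> = convex_cone hull (f ` G1 \<union> uminus ` G2)"
      by (simp add: convex_cone_hull_Un convex_cone_hull_linear_image[OF f]
          convex_cone_hull_linear_image[OF linear_uminus] flip: G1(2) G2(2))
    finally show "polyhedron (fst ` P F)"
      using polyhedron_convex_cone_hull[of "f ` G1 \<union> uminus ` G2"] G1(1) G2(1) by simp
  qed
  then obtain \<kappa> where \<kappa>: "\<And>F. F \<in> closed_faces L \<Longrightarrow> \<kappa> F \<ge> 0"
    "\<And>F d w. F \<in> closed_faces L \<Longrightarrow> (d, w) \<in> P F \<Longrightarrow> \<exists>w'. (d, w') \<in> P F \<and> norm w' \<le> \<kappa> F * norm d"
    by metis
  define \<mu> where "\<mu> = sum \<kappa> (closed_faces L)"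
  have \<mu>: "\<kappa> F \<le> \<mu>" if "F \<in> closed_faces L" for F
    unfolding \<mu>_def using that \<kappa>(1) finite_closed_faces[OF L(1)] by (intro member_le_sum) auto
  have P_sub: "- d - A w \<in> normal_cone L w" if "(d, w) \<in> P F" "F \<in> closed_faces L" for d w F
  proof -
    have "- d - A w \<in> uminus ` polar_cone F"
      using that(1) by (simp add: P_def V_def)
    then obtain x where "x \<in> polar_cone F" "- d - A w = - x"
      by blast
    then have "- (- d - A w) \<in> polar_cone F" by simp
    moreover have w: "w \<in> F" "- d - A w \<in> polar_cone L"
      using that(1) by (auto simp: P_def V_def)
    moreover have wL: "w \<in> L" using w(1) polyhedral_cone_closed_face(3)[OF L that(2)] by blast
    ultimately have "(- d - A w) \<bullet> w \<le> 0" "- (- d - A w) \<bullet> w \<le> 0"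
      unfolding polar_cone_def by blast+
    then have "(- d - A w) \<bullet> w = 0" by (simp only: inner_minus_left)
    with w wL show ?thesis using normal_cone_convex_cone[OF L(2)] by blast
  qed
  show ?thesis
  proof (intro exI[of _ \<mu>] conjI allI impI)
    show "\<mu> \<ge> 0" unfolding \<mu>_def using \<kappa>(1) by (simp add: sum_nonneg)
    fix d w assume n: "- d - A w \<in> normal_cone L w"
    define v where "v = - d - A w"
    \<comment> \<open>The face exposed by the normal vector itself contains \<open>w\<close>, so
      every solution lies in one of the pieces.\<close>
    define F where "F = L \<inter> {x. v \<bullet> x = 0}"
    have v: "w \<in> L" "v \<in> polar_cone L" "v \<bullet> w = 0"
      using n normal_cone_convex_cone[OF L(2)] by (auto simp: v_def)
    then have F: "F \<in> closed_faces L" by (auto simp: mem_closed_faces F_def)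
    have "- v \<in> polar_cone F" by (auto simp: polar_cone_def F_def)
    then have "v \<in> uminus ` polar_cone F" by force
    with v have "(d, w) \<in> P F" by (simp add: P_def V_def F_def v_def[symmetric])
    from \<kappa>(2)[OF F this] obtain w' where w': "(d, w') \<in> P F" "norm w' \<le> \<kappa> F * norm d" by blast
    from w'(2) have "norm w' \<le> \<mu> * norm d"
      using mult_right_mono[OF \<mu>[OF F] norm_ge_zero[of d]] by linarith
    with P_sub[OF w'(1) F] show "\<exists>w'. - d - A w' \<in> normal_cone L w' \<and> norm w' \<le> \<mu> * norm d"
      by blast
  qed
qed

text \<open>The linear bound selects bounded solutions along a convergent sequence of right-hand
  sides; a subsequence converges, and the normal cone graph is closed.\<close>

lemma closed_conic_vi_range:
  fixes L :: "'a::euclidean_space set"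
  assumes L: "polyhedron L" "convex_cone L" and A: "linear A"
  shows "closed {d. \<exists>w. - d - A w \<in> normal_cone L w}" (is "closed ?R")
proof -
  obtain \<kappa> where \<kappa>: "\<kappa> \<ge> 0" "\<And>d w. - d - A w \<in> normal_cone L w \<Longrightarrow>
      \<exists>w'. - d - A w' \<in> normal_cone L w' \<and> norm w' \<le> \<kappa> * norm d"
    using conic_vi_solution_bound[OF assms] by metis
  have "d \<in> ?R" if ds: "\<forall>k. ds k \<in> ?R" and lim: "ds \<longlonglongrightarrow> d" for ds d
  proof -
    have "\<forall>k. \<exists>w. - ds k - A w \<in> normal_cone L w \<and> norm w \<le> \<kappa> * norm (ds k)"
      using ds \<kappa>(2) by blast
    then obtain w where w: "\<And>k. - ds k - A (w k) \<in> normal_cone L (w k)"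
      "\<And>k. norm (w k) \<le> \<kappa> * norm (ds k)" by metis
    obtain B where B: "\<And>k. norm (ds k) \<le> B"
      using convergent_imp_Bseq[of ds] lim by (auto simp: convergent_def Bseq_def)
    have "norm (w k) \<le> \<kappa> * B" for k
      using w(2)[of k] mult_left_mono[OF B[of k] \<kappa>(1)] by linarith
    then have "\<forall>k. w k \<in> cball 0 (\<kappa> * B)" by simp
    then obtain l r where r: "strict_mono (r :: nat \<Rightarrow> nat)" "(w \<circ> r) \<longlonglongrightarrow> l"
      using compact_cball[of "0::'a" "\<kappa> * B"] unfolding compact_def by meson
    have "bounded_linear A" using A by (simp add: linear_conv_bounded_linear)
    moreover have "(\<lambda>k. ds (r k)) \<longlonglongrightarrow> d"
      using LIMSEQ_subseq_LIMSEQ[OF lim r(1)] by (simp add: o_def)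
    moreover have wr: "(\<lambda>k. w (r k)) \<longlonglongrightarrow> l"
      using r(2) by (simp add: o_def)
    ultimately have "(\<lambda>k. - ds (r k) - A (w (r k))) \<longlonglongrightarrow> - d - A l"
      by (intro tendsto_intros bounded_linear.tendsto[of A])
    then have "- d - A l \<in> normal_cone L l"
      by (rule normal_cone_limit[OF polyhedron_imp_closed[OF L(1)] wr]) (rule w)
    then show ?thesis by blast
  qed
  then show ?thesis unfolding closed_sequential_limits by blast
qed

text \<open>The ranges to which this is applied may be nonconvex, so the projection inequality is
  taken on the segment issuing from \<open>p\<close> along \<open>e\<close>.\<close>

lemma closest_point_feasible_direction:
  fixes R :: "'a::euclidean_space set"
  assumes "\<And>y. y \<in> R \<Longrightarrow> dist d p \<le> dist d y" "t > 0" "\<And>s. 0 \<le> s \<Longrightarrow> s \<le> t \<Longrightarrow> p + s *\<^sub>R e \<in> R"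
  shows "(p - d) \<bullet> e \<ge> 0"
proof -
  have "closed_segment p (p + t *\<^sub>R e) \<subseteq> R"
  proof
    fix y assume "y \<in> closed_segment p (p + t *\<^sub>R e)"
    then obtain r where r: "0 \<le> r" "r \<le> 1" "y = (1 - r) *\<^sub>R p + r *\<^sub>R (p + t *\<^sub>R e)"
      by (auto simp: in_segment)
    then have "y = p + (r * t) *\<^sub>R e" by (simp add: algebra_simps)
    moreover have "r * t \<le> t" using r assms(2) by (simp add: mult_left_le_one_le)
    ultimately show "y \<in> R" using assms(2,3) r(1) by simp
  qed
  then have "(d - p) \<bullet> (p + t *\<^sub>R e - p) \<le> 0"
    using assms(1) by (intro any_closest_point_dot[of "closed_segment p (p + t *\<^sub>R e)"]) auto
  then have "(d - p) \<bullet> e \<le> 0" using assms(2) by (simp add: mult_le_0_iff)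
  then show ?thesis by (simp add: inner_diff_left)
qed

text \<open>The residual \<open>p - d\<close> at the point \<open>p\<close> of the (closed, conic) range nearest to \<open>d\<close> satisfies
  the premises of \<open>res\<close>, while \<open>(p - d) \<bullet> p = 0\<close>; so \<open>(p - d) \<bullet> d \<ge> 0\<close> forces \<open>p = d\<close>.\<close>

lemma conic_vi_solvable:
  fixes L :: "'a::euclidean_space set"
  assumes L: "polyhedron L" "convex_cone L" and A: "linear A"
    and res: "\<And>u v z. v \<in> normal_cone L u \<Longrightarrow> z \<in> critical_cone L u v \<Longrightarrow>
      z \<in> polar_cone (A ` critical_cone L u v) \<Longrightarrow> z \<bullet> d \<ge> 0"
  shows "\<exists>w. - d - A w \<in> normal_cone L w"
proof -
  define R where "R = {d. \<exists>w. - d - A w \<in> normal_cone L w}"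
  have "closed R" unfolding R_def by (rule closed_conic_vi_range[OF L A])
  moreover have "0 \<in> R"
    unfolding R_def using normal_cone_convex_cone[OF L(2)] convex_cone_contains_0[OF L(2)]
    by (intro CollectI exI[of _ 0]) (simp add: linear_0[OF A] polar_cone_def)
  ultimately obtain p where p: "p \<in> R" "\<And>y. y \<in> R \<Longrightarrow> dist d p \<le> dist d y"
    using closest_point_exists[of R d] by blast
  have feas: "(p - d) \<bullet> e \<ge> 0" if "t > 0" "\<And>s. 0 \<le> s \<Longrightarrow> s \<le> t \<Longrightarrow> p + s *\<^sub>R e \<in> R" for e t
    by (rule closest_point_feasible_direction[OF p(2) that])
  define z where "z = p - d"
  obtain u where n: "- p - A u \<in> normal_cone L u" using p(1) unfolding R_def by blast
  define v where "v = - p - A u"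
  have nv: "v \<in> normal_cone L u" using n by (simp add: v_def)
  then have v: "u \<in> L" "v \<in> polar_cone L" "v \<bullet> u = 0"
    using normal_cone_convex_cone[OF L(2)] by auto
  \<comment> \<open>Moving \<open>u\<close> along a critical direction keeps \<open>v\<close> normal
    and moves the right-hand side along \<open>- A w\<close>.\<close>
  have zA: "z \<bullet> A w \<le> 0" if "w \<in> critical_cone L u v" for w
  proof -
    have "\<exists>t>0. \<forall>s. 0 \<le> s \<and> s \<le> t \<longrightarrow> v \<in> normal_cone L (u + s *\<^sub>R w)"
      using that by (rule mem_critical_cone_normal_cone[OF L(1) nv, THEN iffD1])
    then obtain t where t: "t > 0" "\<And>s. 0 \<le> s \<Longrightarrow> s \<le> t \<Longrightarrow> v \<in> normal_cone L (u + s *\<^sub>R w)"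
      by (elim exE conjE) simp
    have "p + s *\<^sub>R (- A w) \<in> R" if "0 \<le> s" "s \<le> t" for s
    proof -
      have eq: "- (p + s *\<^sub>R (- A w)) - A (u + s *\<^sub>R w) = v"
        by (simp add: v_def linear_add[OF A] linear_scale[OF A])
      from t(2)[OF that] show ?thesis unfolding R_def eq[symmetric] by blast
    qed
    from feas[OF t(1) this] show ?thesis by (simp add: z_def)
  qed
  \<comment> \<open>Here \<open>u\<close> is fixed and the normal varies, which moves the right-hand
    side along \<open>- n'\<close>.\<close>
  have zn: "z \<bullet> n' \<le> 0" if t: "t > 0" "\<And>s. 0 \<le> s \<Longrightarrow> s \<le> t \<Longrightarrow> v + s *\<^sub>R n' \<in> normal_cone L u" for n' t
  proof -
    have "p + s *\<^sub>R (- n') \<in> R" if "0 \<le> s" "s \<le> t" for s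
    proof -
      have eq: "- (p + s *\<^sub>R (- n')) - A u = v + s *\<^sub>R n'" by (simp add: v_def)
      from t(2)[OF that] show ?thesis unfolding R_def eq[symmetric] by blast
    qed
    from feas[OF t(1) this] show ?thesis by (simp add: z_def)
  qed
  have conv: "normal_cone L u = polar_cone (contingent_cone L u)"
    using regular_normal_cone_convex[OF polyhedron_imp_convex[OF L(1)]] v(1)
    by (metis regular_normal_cone_def)
  have vn: "v \<in> polar_cone (contingent_cone L u)" using nv conv by simp
  have zn': "z \<bullet> n' \<le> 0" if "n' \<in> polar_cone (contingent_cone L u)" for n'
    using convex_cone_add[OF convex_cone_polar_cone vn convex_cone_scaleR[OF convex_cone_polar_cone _ that]]
    by (intro zn[of 1]) (auto simp: conv)
  note T = polyhedron_contingent_cone[OF L(1) v(1)]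
  have "z \<in> contingent_cone L u"
    by (rule polar_polar_cone[OF polyhedron_imp_closed[OF T(1)] T(2)]) (use zn' in \<open>simp add: polar_cone_def\<close>)
  \<comment> \<open>Shrinking \<open>v\<close> towards 0 stays in the cone of normals, so
    \<open>- v\<close> is an admissible variation too; with \<open>zn'\<close> this yields
    orthogonality of \<open>z\<close> and \<open>v\<close>.\<close>
  moreover have "v + s *\<^sub>R (- v) \<in> normal_cone L u" if "0 \<le> s" "s \<le> 1" for s
    using convex_cone_scaleR[OF convex_cone_polar_cone _ vn, of "1 - s"] that
    by (simp add: conv algebra_simps)
  then have "z \<bullet> (- v) \<le> 0" using zn[of 1 "- v"] by simp
  with zn'[OF vn] have "v \<bullet> z = 0" by (simp add: inner_commute)
  ultimately have zcrit: "z \<in> critical_cone L u v"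
    by (simp add: critical_cone_def mem_orthogonal_comp_span_singleton)
  have "z \<bullet> d \<ge> 0"
    using zA by (intro res[OF nv zcrit]) (auto simp: polar_cone_def)
  moreover have Rcone: "c *\<^sub>R p \<in> R" if "c \<ge> 0" for c
  proof -
    have eq: "- (c *\<^sub>R p) - A (c *\<^sub>R u) = c *\<^sub>R v"
      by (simp add: v_def linear_scale[OF A] algebra_simps)
    have "c *\<^sub>R v \<in> normal_cone L (c *\<^sub>R u)"
      using v that convex_cone_scaleR[OF L(2)] convex_cone_scaleR[OF convex_cone_polar_cone]
      by (simp add: normal_cone_convex_cone[OF L(2)])
    then show ?thesis unfolding R_def eq[symmetric] by blast
  qed
  \<comment> \<open>Since \<open>R\<close> is closed under nonnegative scaling, one may move from
    \<open>p\<close> towards the origin.\<close>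
  have "z \<bullet> p \<le> 0"
  proof -
    have "p + s *\<^sub>R (- p) \<in> R" if "0 \<le> s" "s \<le> 1" for s
      using Rcone[of "1 - s"] that by (simp add: algebra_simps)
    from feas[OF zero_less_one this] show ?thesis by (simp add: z_def)
  qed
  ultimately have "z \<bullet> z \<le> 0" by (simp add: z_def inner_diff_right)
  then have "z = 0" by (metis antisym inner_eq_zero_iff inner_ge_zero)
  then have "p = d" by (simp add: z_def)
  with p(1) show ?thesis by (simp add: R_def)
qed

section \<open>Local properties of critical cones and continuation along segments\<close>

text \<open>Lets arbitrary points of the graph of the normal cone map of \<open>L\<close> be shrunk
  into the neighbourhood where the reduction is valid.\<close>

lemma critical_cone_scaleR:
  fixes L :: "'a::euclidean_space set"
  assumes L: "polyhedron L" "convex_cone L" and u: "u \<in> L" and t: "t > 0"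
  shows "critical_cone L (t *\<^sub>R u) (t *\<^sub>R v) = critical_cone L u v"
proof -
  have tu: "t *\<^sub>R u \<in> L" using convex_cone_scaleR[OF L(2) _ u] t by simp
  have "(\<exists>r>0. t *\<^sub>R u + r *\<^sub>R w \<in> L) \<longleftrightarrow> (\<exists>r>0. u + r *\<^sub>R w \<in> L)" for w
  proof
    assume "\<exists>r>0. t *\<^sub>R u + r *\<^sub>R w \<in> L"
    then obtain r where r: "r > 0" "t *\<^sub>R u + r *\<^sub>R w \<in> L" by blast
    with t have "u + (r / t) *\<^sub>R w \<in> L"
      using convex_cone_scaleR[OF L(2) _ r(2), of "inverse t"]
      by (simp add: scaleR_add_right divide_inverse mult.commute)
    with r t show "\<exists>r>0. u + r *\<^sub>R w \<in> L" by (intro exI[of _ "r / t"]) simp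
  next
    assume "\<exists>r>0. u + r *\<^sub>R w \<in> L"
    then obtain r where r: "r > 0" "u + r *\<^sub>R w \<in> L" by blast
    with t have "t *\<^sub>R u + (t * r) *\<^sub>R w \<in> L"
      using convex_cone_scaleR[OF L(2) _ r(2), of t] by (simp add: scaleR_add_right)
    with r t show "\<exists>r>0. t *\<^sub>R u + r *\<^sub>R w \<in> L" by (intro exI[of _ "t * r"]) simp
  qed
  then show ?thesis
    using t by (auto simp: mem_critical_cone[OF L(1) u] mem_critical_cone[OF L(1) tu])
qed

lemma normal_cone_scaleR:
  assumes "convex_cone L" "v \<in> normal_cone L u" "t \<ge> 0"
  shows "t *\<^sub>R v \<in> normal_cone L (t *\<^sub>R u)"
  using assms convex_cone_scaleR[OF assms(1)] convex_cone_scaleR[OF convex_cone_polar_cone[of L]]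
  by (simp add: normal_cone_convex_cone[OF assms(1)])

text \<open>Both \<open>u + u\<close> and \<open>u - u\<close> lie in \<open>K\<close>, so
  \<open>u\<close> spans a line in the critical cone. Hence a vector polar to the image of that cone
  under a linear map is orthogonal to the image of \<open>u\<close>; this later permits exchanging
  \<open>qb\<close> for a nearby right-hand side.\<close>

lemma critical_cone_lineality:
  fixes K :: "'a::euclidean_space set"
  assumes K: "polyhedron K" "convex_cone K" and v: "v \<in> normal_cone K u"
  shows "u \<in> critical_cone K u v" "- u \<in> critical_cone K u v"
    "w \<in> critical_cone K u v \<Longrightarrow> v \<bullet> w = 0"
proof -
  have u: "u \<in> K" "v \<bullet> u = 0" using v normal_cone_convex_cone[OF K(2)] by auto
  show "u \<in> critical_cone K u v"
    using u convex_cone_add[OF K(2) u(1) u(1)] mem_critical_cone[OF K(1) u(1)]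
    by (auto intro: exI[of _ 1])
  show "- u \<in> critical_cone K u v"
    using u convex_cone_contains_0[OF K(2)] mem_critical_cone[OF K(1) u(1)]
    by (auto intro: exI[of _ 1])
  show "w \<in> critical_cone K u v \<Longrightarrow> v \<bullet> w = 0"
    using mem_critical_cone[OF K(1) u(1)] by blast
qed

lemma small_scale_pair:
  fixes u :: "'a::real_normed_vector" and v :: "'b::real_normed_vector"
  assumes "\<epsilon> > 0"
  obtains t :: real where "0 < t" "t \<le> 1"
    "\<And>s. 0 \<le> s \<Longrightarrow> s \<le> t \<Longrightarrow> norm (s *\<^sub>R u) < \<epsilon> \<and> norm (s *\<^sub>R v) < \<epsilon>"
proof -
  obtain t where t: "0 < t" "t \<le> 1" "norm (t *\<^sub>R (u, v)) < \<epsilon>"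
    using small_scale[OF assms] by metis
  have "norm (s *\<^sub>R u) < \<epsilon> \<and> norm (s *\<^sub>R v) < \<epsilon>" if "0 \<le> s" "s \<le> t" for s
  proof -
    have "norm (s *\<^sub>R (u, v)) \<le> norm (t *\<^sub>R (u, v))"
      unfolding norm_scaleR using that by (simp add: mult_right_mono)
    then show ?thesis
      using norm_fst_le[of "s *\<^sub>R u" "s *\<^sub>R v"] norm_snd_le[of "s *\<^sub>R v" "s *\<^sub>R u"] t(3) by simp
  qed
  with t that show thesis by blast
qed

text \<open>The critical cones are differences of closed faces, so there are finitely many and the
  sum of their constants serves them all.\<close>

lemma uniform_conic_vi_solution_bound:
  fixes K :: "'a::euclidean_space set"
  assumes K: "polyhedron K" "convex_cone K" and A: "linear A"
  obtains \<kappa> where "\<kappa> \<ge> 0"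
    "\<And>u v d w. v \<in> normal_cone K u \<Longrightarrow> - d - A w \<in> normal_cone (critical_cone K u v) w \<Longrightarrow>
      \<exists>w'. - d - A w' \<in> normal_cone (critical_cone K u v) w' \<and> norm w' \<le> \<kappa> * norm d"
proof -
  define \<L> where "\<L> = {critical_cone K u v |u v. v \<in> normal_cone K u}"
  have "\<L> \<subseteq> (\<lambda>(F1, F2). difference_set F1 F2) ` (closed_faces K \<times> closed_faces K)"
    using critical_cone_eq_difference_set[OF K] unfolding \<L>_def by fast
  then have fin: "finite \<L>"
    using finite_closed_faces[OF K(1)] by (meson finite_SigmaI finite_imageI finite_subset)
  have "\<forall>L\<in>\<L>. \<exists>\<kappa>\<ge>0. \<forall>d w. - d - A w \<in> normal_cone L w \<longrightarrow>
      (\<exists>w'. - d - A w' \<in> normal_cone L w' \<and> norm w' \<le> \<kappa> * norm d)"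
  proof
    fix L assume "L \<in> \<L>"
    then obtain u v where "v \<in> normal_cone K u" "L = critical_cone K u v" unfolding \<L>_def by blast
    then show "\<exists>\<kappa>\<ge>0. \<forall>d w. - d - A w \<in> normal_cone L w \<longrightarrow>
        (\<exists>w'. - d - A w' \<in> normal_cone L w' \<and> norm w' \<le> \<kappa> * norm d)"
      using polyhedron_critical_cone[OF K(1)]
      by (intro conic_vi_solution_bound A) (auto simp: normal_cone_def)
  qed
  then obtain \<kappa> where \<kappa>: "\<And>L. L \<in> \<L> \<Longrightarrow> \<kappa> L \<ge> 0"
    "\<And>L d w. L \<in> \<L> \<Longrightarrow> - d - A w \<in> normal_cone L w \<Longrightarrow>
      \<exists>w'. - d - A w' \<in> normal_cone L w' \<and> norm w' \<le> \<kappa> L * norm d"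
    by metis
  show thesis
  proof
    show "sum \<kappa> \<L> \<ge> 0" using \<kappa>(1) by (simp add: sum_nonneg)
    fix u v d w assume v: "v \<in> normal_cone K u" "- d - A w \<in> normal_cone (critical_cone K u v) w"
    have L: "critical_cone K u v \<in> \<L>" using v(1) by (auto simp: \<L>_def)
    have "\<kappa> (critical_cone K u v) \<le> sum \<kappa> \<L>"
      using L fin \<kappa>(1) by (intro member_le_sum) auto
    then have "\<kappa> (critical_cone K u v) * norm d \<le> sum \<kappa> \<L> * norm d" by (simp add: mult_right_mono)
    with \<kappa>(2)[OF L v(2)] show "\<exists>w'. - d - A w' \<in> normal_cone (critical_cone K u v) w' \<and> norm w' \<le> sum \<kappa> \<L> * norm d"
      by (meson order_trans)
  qed
qed

text \<open>The parameters in [0,1] reachable within the speed bound form a compact set; its largest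
  element cannot be below 1, since \<open>step\<close> would extend it.\<close>

lemma segment_continuation:
  fixes S :: "'a::euclidean_space \<Rightarrow> 'b::euclidean_space set"
  assumes cl: "closed (gph S)" and \<kappa>: "\<kappa> \<ge> 0" and x: "x \<in> S q"
    and step: "\<And>s y. 0 \<le> s \<Longrightarrow> s < 1 \<Longrightarrow> y \<in> S (q + s *\<^sub>R d) \<Longrightarrow> norm (y - x) \<le> \<kappa> * (s * norm d) \<Longrightarrow>
      \<exists>w t. norm w \<le> \<kappa> * norm d \<and> t > 0 \<and> (\<forall>r. 0 \<le> r \<and> r \<le> t \<longrightarrow> y + r *\<^sub>R w \<in> S (q + s *\<^sub>R d + r *\<^sub>R d))"
  shows "\<exists>y\<in>S (q + d). norm (y - x) \<le> \<kappa> * norm d"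
proof -
  define E where "E = {p. snd p \<in> S (q + fst p *\<^sub>R d) \<and> norm (snd p - x) \<le> \<kappa> * (fst p * norm d)}
      \<inter> {0..1} \<times> cball x (\<kappa> * norm d)"
  have "closed ((\<lambda>p. (q + fst p *\<^sub>R d, snd p)) -` gph S)"
    by (intro closed_vimage cl continuous_intros)
  moreover have "closed {p :: real \<times> 'b. norm (snd p - x) \<le> \<kappa> * (fst p * norm d)}"
    by (intro closed_Collect_le continuous_intros)
  ultimately have "closed ((\<lambda>p. (q + fst p *\<^sub>R d, snd p)) -` gph S \<inter> {p. norm (snd p - x) \<le> \<kappa> * (fst p * norm d)})"
    by (rule closed_Int)
  moreover have "(\<lambda>p. (q + fst p *\<^sub>R d, snd p)) -` gph S \<inter> {p. norm (snd p - x) \<le> \<kappa> * (fst p * norm d)}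
      = {p. snd p \<in> S (q + fst p *\<^sub>R d) \<and> norm (snd p - x) \<le> \<kappa> * (fst p * norm d)}"
    by (auto simp: gph_def)
  ultimately have "compact E"
    unfolding E_def by (intro closed_Int_compact compact_Times compact_Icc compact_cball) simp
  then have "compact (fst ` E)"
    by (intro compact_continuous_image continuous_intros)
  moreover have "(0, x) \<in> E" using x \<kappa> by (simp add: E_def)
  then have "0 \<in> fst ` E" by force
  ultimately obtain s where s: "s \<in> fst ` E" "\<And>r. r \<in> fst ` E \<Longrightarrow> r \<le> s"
    using compact_attains_sup[of "fst ` E"] by blast
  then obtain y where y: "(s, y) \<in> E" by force
  then have sy: "0 \<le> s" "s \<le> 1" "y \<in> S (q + s *\<^sub>R d)" "norm (y - x) \<le> \<kappa> * (s * norm d)"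
    by (auto simp: E_def)
  have "\<not> s < 1"
  proof
    assume s1: "s < 1"
    from step[OF sy(1) s1 sy(3,4)] obtain w t where w: "norm w \<le> \<kappa> * norm d" "t > 0"
      "\<And>r. 0 \<le> r \<Longrightarrow> r \<le> t \<Longrightarrow> y + r *\<^sub>R w \<in> S (q + s *\<^sub>R d + r *\<^sub>R d)" by blast
    \<comment> \<open>Capped at \<open>1 - s\<close> so that the extension does not pass the end of
      the segment.\<close>
    define r where "r = min t (1 - s)"
    have r: "0 < r" "r \<le> t" "s + r \<le> 1" using w(2) s1 by (auto simp: r_def)
    have "norm (y + r *\<^sub>R w - x) \<le> norm (y - x) + norm (r *\<^sub>R w)"
      using norm_triangle_ineq[of "y - x" "r *\<^sub>R w"] by (simp add: algebra_simps)
    also have "\<dots> \<le> \<kappa> * (s * norm d) + r * (\<kappa> * norm d)"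
      using sy(4) w(1) r(1) by (intro add_mono) (simp_all add: mult_left_mono)
    finally have le: "norm (y + r *\<^sub>R w - x) \<le> \<kappa> * ((s + r) * norm d)" by (simp add: algebra_simps)
    also have "\<dots> \<le> \<kappa> * (1 * norm d)"
      using r \<kappa> by (intro mult_left_mono mult_right_mono) auto
    finally have "y + r *\<^sub>R w \<in> cball x (\<kappa> * norm d)"
      by (simp add: dist_norm norm_minus_commute)
    moreover have "y + r *\<^sub>R w \<in> S (q + (s + r) *\<^sub>R d)"
      using w(3)[of r] r by (simp add: algebra_simps)
    ultimately have "(s + r, y + r *\<^sub>R w) \<in> E"
      using le r sy(1) by (simp add: E_def)
    then have "s + r \<in> fst ` E" by force
    with s(2) r(1) show False by fastforce
  qed
  with sy show ?thesis by (intro bexI[of _ y]) auto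
qed

section \<open>Affine variational inequalities\<close>

lemma mem_avi_solution:
  assumes "polyhedron C"
  shows "x \<in> avi_solution C M q \<longleftrightarrow> - q - M *v x \<in> normal_cone C x"
proof -
  have "0 = q + M *v x + v \<longleftrightarrow> v = - q - M *v x" for v
    by (auto simp: algebra_simps eq_neg_iff_add_eq_0)
  then show ?thesis
    by (simp add: avi_solution_def
        limiting_normal_cone_convex[OF polyhedron_imp_convex polyhedron_imp_closed, OF assms assms])
qed

lemma mem_gph: "p \<in> gph S \<longleftrightarrow> snd p \<in> S (fst p)"
  by (simp add: gph_def case_prod_beta)

lemma closed_gph_avi_solution:
  assumes "polyhedron C"
  shows "closed (gph (avi_solution C M))"
  unfolding closed_sequential_limits
proof (intro allI impI, elim conjE)
  fix p l assume p: "\<forall>k. p k \<in> gph (avi_solution C M)" and lim: "p \<longlonglongrightarrow> l"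
  have "(\<lambda>k. - fst (p k) - M *v snd (p k)) \<longlonglongrightarrow> - fst l - M *v snd l"
    by (intro tendsto_intros lim bounded_linear.tendsto[OF matrix_vector_mul_bounded_linear])
  then have "- fst l - M *v snd l \<in> normal_cone C (snd l)"
    by (rule normal_cone_limit[OF polyhedron_imp_closed[OF assms] tendsto_snd[OF lim]])
      (use p in \<open>simp add: mem_gph mem_avi_solution[OF assms]\<close>)
  then show "l \<in> gph (avi_solution C M)"
    by (simp add: mem_gph mem_avi_solution[OF assms])
qed

text \<open>Differences of nested closed faces and critical cones of \<open>K\<close> are the same
  family, and for convex \<open>Q\<close> the condition that \<open>- z\<close> be normal at
  \<open>qb\<close> is a linear inequality over \<open>Q\<close>.\<close>

lemma generalized_critical_face_condition_iff:
  assumes Q: "polyhedron Q" "qb \<in> Q" and K: "polyhedron K" "convex_cone K"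
  shows "generalized_critical_face_condition M K Q qb \<longleftrightarrow>
    (\<forall>u v. v \<in> normal_cone K u \<longrightarrow>
      (\<forall>z \<in> critical_cone K u v \<inter> polar_cone ((*v) M ` critical_cone K u v). \<forall>q\<in>Q. z \<bullet> (q - qb) \<ge> 0))"
proof -
  have "z \<in> uminus ` limiting_normal_cone Q qb \<longleftrightarrow> (\<forall>q\<in>Q. z \<bullet> (q - qb) \<ge> 0)" for z
  proof -
    have "z \<in> uminus ` limiting_normal_cone Q qb \<longleftrightarrow> - z \<in> limiting_normal_cone Q qb"
      by (metis imageE imageI minus_minus)
    then show ?thesis
      using Q(2) by (simp add: normal_cone_def
          limiting_normal_cone_convex[OF polyhedron_imp_convex polyhedron_imp_closed, OF Q(1) Q(1)])
  qed
  moreover have "(\<forall>F1 \<in> closed_faces K. \<forall>F2 \<in> closed_faces K. F2 \<subseteq> F1 \<longrightarrow> P (difference_set F1 F2))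
      \<longleftrightarrow> (\<forall>u v. v \<in> normal_cone K u \<longrightarrow> P (critical_cone K u v))" (is "?l \<longleftrightarrow> ?r") for P
  proof
    assume ?l
    then show ?r using critical_cone_eq_difference_set[OF K] by metis
  next
    assume ?r
    then show ?l using difference_set_closed_faces[OF K] by metis
  qed
  ultimately show ?thesis
    unfolding generalized_critical_face_condition_def face_normals_def by (simp add: subset_iff Ball_def)
qed

section \<open>Sufficiency of the face condition\<close>

text \<open>At a nearby graph point with critical cone \<open>L\<close>, a solution \<open>w\<close>
  of the conic problem over \<open>L\<close> for the direction \<open>q' - q\<close> is an exact
  solution path for short times, because the reduction is an equivalence. Finiteness of the critical
  cones makes \<open>\<kappa>\<close> independent of the point.\<close>

lemma avi_solution_feasible_step:
  fixes C Q :: "(real^'n) set"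
  assumes C: "polyhedron C" and Q: "polyhedron Q" "qb \<in> Q"
    and vb: "vb \<in> normal_cone C xb" "vb = - (M *v xb) - qb"
    and K: "K = critical_cone C xb vb"
    and gcf: "generalized_critical_face_condition M K Q qb"
  obtains \<epsilon> \<kappa> where "\<epsilon> > 0" "\<kappa> \<ge> 0"
    "\<And>q x q'. x \<in> avi_solution C M q \<Longrightarrow> norm (x - xb) < \<epsilon> \<Longrightarrow> norm (- q - M *v x - vb) < \<epsilon> \<Longrightarrow> q' \<in> Q \<Longrightarrow>
      \<exists>w t. norm w \<le> \<kappa> * norm (q' - q) \<and> t > 0 \<and>
        (\<forall>s. 0 \<le> s \<and> s \<le> t \<longrightarrow> x + s *\<^sub>R w \<in> avi_solution C M (q + s *\<^sub>R (q' - q)))"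
proof -
  have "xb \<in> C" using vb(1) by (simp add: normal_cone_def)
  note Kc = polyhedron_critical_cone[OF C this, of vb, folded K]
  have gcf': "z \<bullet> (q - qb) \<ge> 0"
    if "v \<in> normal_cone K u" "z \<in> critical_cone K u v" "z \<in> polar_cone ((*v) M ` critical_cone K u v)" "q \<in> Q"
    for u v z q
    using gcf that unfolding generalized_critical_face_condition_iff[OF Q Kc] by blast
  have M: "linear ((*v) M)" by (rule matrix_vector_mul_linear)
  obtain \<epsilon> where \<epsilon>: "\<epsilon> > 0"
    "\<And>u v. norm u < \<epsilon> \<Longrightarrow> norm v < \<epsilon> \<Longrightarrow> vb + v \<in> normal_cone C (xb + u) \<longleftrightarrow> v \<in> normal_cone K u"
    "\<And>u v. norm u < \<epsilon> \<Longrightarrow> norm v < \<epsilon> \<Longrightarrow> v \<in> normal_cone K u \<Longrightarrow>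
      critical_cone C (xb + u) (vb + v) = critical_cone K u v"
    using normal_cone_reduction[OF C vb(1)] unfolding K by blast
  obtain \<kappa> where \<kappa>: "\<kappa> \<ge> 0"
    "\<And>u v d w. v \<in> normal_cone K u \<Longrightarrow> - d - M *v w \<in> normal_cone (critical_cone K u v) w \<Longrightarrow>
      \<exists>w'. - d - M *v w' \<in> normal_cone (critical_cone K u v) w' \<and> norm w' \<le> \<kappa> * norm d"
    using uniform_conic_vi_solution_bound[OF Kc M] by metis
  have "\<exists>w t. norm w \<le> \<kappa> * norm (q' - q) \<and> t > 0 \<and>
      (\<forall>s. 0 \<le> s \<and> s \<le> t \<longrightarrow> x + s *\<^sub>R w \<in> avi_solution C M (q + s *\<^sub>R (q' - q)))"
    if xS: "x \<in> avi_solution C M q" and x: "norm (x - xb) < \<epsilon>" and v: "norm (- q - M *v x - vb) < \<epsilon>"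
      and q': "q' \<in> Q" for q x q'
  proof -
    define u where "u = x - xb"
    define v0 where "v0 = - q - M *v x - vb"
    define L where "L = critical_cone K u v0"
    have nx: "vb + v0 \<in> normal_cone C (xb + u)"
      using xS by (simp add: mem_avi_solution[OF C] u_def v0_def)
    have uv: "norm u < \<epsilon>" "norm v0 < \<epsilon>" using x v by (simp_all add: u_def v0_def)
    have nu: "v0 \<in> normal_cone K u" using \<epsilon>(2)[OF uv] nx by simp
    have LC: "L = critical_cone C (xb + u) (vb + v0)"
      unfolding L_def using \<epsilon>(3)[OF uv nu] by simp
    have uK: "u \<in> K" using nu by (simp add: normal_cone_def)
    note Lc = polyhedron_critical_cone[OF Kc(1) uK, of v0, folded L_def]
    note lin = critical_cone_lineality[OF Kc nu, folded L_def]
    obtain \<epsilon>' where \<epsilon>': "\<epsilon>' > 0"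
      "\<And>u' v'. norm u' < \<epsilon>' \<Longrightarrow> norm v' < \<epsilon>' \<Longrightarrow> v0 + v' \<in> normal_cone K (u + u') \<longleftrightarrow> v' \<in> normal_cone L u'"
      "\<And>u' v'. norm u' < \<epsilon>' \<Longrightarrow> norm v' < \<epsilon>' \<Longrightarrow> v' \<in> normal_cone L u' \<Longrightarrow>
        critical_cone K (u + u') (v0 + v') = critical_cone L u' v'"
      using normal_cone_reduction[OF Kc(1) nu] unfolding L_def by blast
    \<comment> \<open>The premise of \<open>conic_vi_solvable\<close>: a critical cone of
      \<open>L\<close> is one of \<open>K\<close> at a nearby point, so the face condition gives the
      sign for \<open>q' - qb\<close>; then \<open>qb\<close> is exchanged for
      \<open>q\<close>.\<close>
    have "z \<bullet> (q' - q) \<ge> 0"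
      if n': "v' \<in> normal_cone L u'" and z: "z \<in> critical_cone L u' v'"
        "z \<in> polar_cone ((*v) M ` critical_cone L u' v')" for u' v' z
    proof -
      have u': "u' \<in> L" "v' \<in> polar_cone L" "v' \<bullet> u' = 0"
        using n' normal_cone_convex_cone[OF Lc(2)] by auto
      obtain t where t: "0 < t" "norm (t *\<^sub>R u') < \<epsilon>'" "norm (t *\<^sub>R v') < \<epsilon>'"
        using small_scale_pair[OF \<epsilon>'(1), of u' v'] by (metis less_eq_real_def order_refl)
      have tn: "t *\<^sub>R v' \<in> normal_cone L (t *\<^sub>R u')"
        using normal_cone_scaleR[OF Lc(2) n'] t(1) by simp
      have eq: "critical_cone K (u + t *\<^sub>R u') (v0 + t *\<^sub>R v') = critical_cone L u' v'"
        unfolding \<epsilon>'(3)[OF t(2,3) tn] by (rule critical_cone_scaleR[OF Lc u'(1) t(1)])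
      have "z \<bullet> (q' - qb) \<ge> 0"
        using gcf'[of "v0 + t *\<^sub>R v'" "u + t *\<^sub>R u'" z q'] \<epsilon>'(2)[OF t(2,3)] tn z q' by (simp add: eq)
      \<comment> \<open>The vector \<open>q - qb\<close> is \<open>- v0 - M u\<close>. Here
        \<open>v0\<close> vanishes on \<open>L\<close>, hence on \<open>z\<close>, and both
        \<open>u\<close> and \<open>- u\<close> lie in the critical cone to whose image under
        \<open>M\<close> the vector \<open>z\<close> is polar.\<close>
      moreover have "z \<bullet> (q - qb) = 0"
      proof -
        have "v0 \<bullet> z = 0"
        proof -
          obtain r where r: "r > 0" "u' + r *\<^sub>R z \<in> L"
            using z(1) mem_critical_cone[OF Lc(1) u'(1)] by blast
          have "v0 \<bullet> (u' + r *\<^sub>R z) = 0" by (rule lin(3)[OF r(2)])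
          then show ?thesis using r(1) lin(3)[OF u'(1)] by (simp add: inner_add_right)
        qed
        moreover
        have "v' \<bullet> u \<le> 0" "v' \<bullet> (- u) \<le> 0"
          using u'(2) lin(1,2) unfolding polar_cone_def by blast+
        then have "v' \<bullet> u = 0" by simp
        then have "u \<in> critical_cone L u' v'" "- u \<in> critical_cone L u' v'"
          using convex_cone_add[OF Lc(2) u'(1) lin(1)] convex_cone_add[OF Lc(2) u'(1) lin(2)]
          by (auto simp: mem_critical_cone[OF Lc(1) u'(1)] intro!: exI[of _ 1])
        then have "z \<bullet> (M *v u) \<le> 0" "z \<bullet> (M *v (- u)) \<le> 0"
          using z(2) unfolding polar_cone_def by blast+
        then have "z \<bullet> (M *v u) = 0" by (simp add: linear_neg[OF M])
        moreover have "q - qb = - v0 - M *v u"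
          by (simp add: v0_def u_def vb(2) linear_diff[OF M])
        ultimately show ?thesis by (simp add: inner_diff_right inner_commute)
      qed
      ultimately show ?thesis by (simp add: inner_diff_right)
    qed
    then obtain w where "- (q' - q) - M *v w \<in> normal_cone L w"
      using conic_vi_solvable[OF Lc M] by blast
    then obtain w where w: "- (q' - q) - M *v w \<in> normal_cone L w" "norm w \<le> \<kappa> * norm (q' - q)"
      using \<kappa>(2)[OF nu] unfolding L_def by blast
    define n where "n = - (q' - q) - M *v w"
    obtain \<delta> where \<delta>: "\<delta> > 0"
      "\<And>u' v'. norm u' < \<delta> \<Longrightarrow> norm v' < \<delta> \<Longrightarrow>
        vb + v0 + v' \<in> normal_cone C (xb + u + u') \<longleftrightarrow> v' \<in> normal_cone L u'"
      using normal_cone_reduction[OF C nx] unfolding LC by metis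
    obtain t where t: "0 < t" "\<And>s. 0 \<le> s \<Longrightarrow> s \<le> t \<Longrightarrow> norm (s *\<^sub>R w) < \<delta> \<and> norm (s *\<^sub>R n) < \<delta>"
      using small_scale_pair[OF \<delta>(1)] by metis
    have "x + s *\<^sub>R w \<in> avi_solution C M (q + s *\<^sub>R (q' - q))" if s: "0 \<le> s \<and> s \<le> t" for s
    proof -
      have "s *\<^sub>R n \<in> normal_cone L (s *\<^sub>R w)"
        using normal_cone_scaleR[OF Lc(2) w(1)] s by (simp add: n_def)
      then have "vb + v0 + s *\<^sub>R n \<in> normal_cone C (xb + u + s *\<^sub>R w)"
        using \<delta>(2) t(2) s by blast
      moreover have "vb + v0 + s *\<^sub>R n = - (q + s *\<^sub>R (q' - q)) - M *v (x + s *\<^sub>R w)"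
        by (simp add: v0_def n_def linear_add[OF M] linear_scale[OF M] algebra_simps)
      ultimately show ?thesis by (simp add: mem_avi_solution[OF C] u_def)
    qed
    with w(2) t(1) show ?thesis by blast
  qed
  with \<epsilon>(1) \<kappa>(1) show thesis using that by blast
qed

lemma mem_scaled_cball:
  fixes x :: "'a::real_normed_vector"
  assumes "r \<ge> 0"
  shows "x \<in> {y + r *\<^sub>R b |y b. y \<in> A \<and> b \<in> cball 0 1} \<longleftrightarrow> (\<exists>y\<in>A. norm (x - y) \<le> r)"
proof
  assume "x \<in> {y + r *\<^sub>R b |y b. y \<in> A \<and> b \<in> cball 0 1}"
  then obtain y b where "y \<in> A" "norm b \<le> 1" "x = y + r *\<^sub>R b" by auto
  moreover from this have "norm (x - y) \<le> r" using assms by (simp add: mult_left_le)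
  ultimately show "\<exists>y\<in>A. norm (x - y) \<le> r" by blast
next
  assume "\<exists>y\<in>A. norm (x - y) \<le> r"
  then obtain y where y: "y \<in> A" "norm (x - y) \<le> r" by blast
  show "x \<in> {y + r *\<^sub>R b |y b. y \<in> A \<and> b \<in> cball 0 1}"
  proof (cases "r = 0")
    case True
    with y have "x = y + r *\<^sub>R 0" by simp
    with y(1) show ?thesis by (intro CollectI exI[of _ y] exI[of _ 0]) auto
  next
    case False
    then have "x = y + r *\<^sub>R ((x - y) /\<^sub>R r)" by simp
    moreover have "(x - y) /\<^sub>R r \<in> cball 0 1"
      using y(2) False assms by (simp add: divide_inverse_commute[symmetric] divide_le_eq)
    ultimately show ?thesis using y(1) by blast
  qed
qed

lemma lipschitz_like_rel_iff:
  "lipschitz_like_rel S Q qb xb \<longleftrightarrow>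
    qb \<in> Q \<and> xb \<in> S qb \<and> locally_closed_at (gph S) (qb, xb) \<and>
    (\<exists>\<delta> \<kappa>. \<delta> > 0 \<and> \<kappa> \<ge> 0 \<and> (\<forall>q \<in> Q \<inter> ball qb \<delta>. \<forall>q' \<in> Q \<inter> ball qb \<delta>. \<forall>x \<in> S q' \<inter> ball xb \<delta>.
      \<exists>y \<in> S q. norm (x - y) \<le> \<kappa> * norm (q' - q)))" (is "?l \<longleftrightarrow> ?r")
proof
  assume ?l
  then obtain V W \<kappa> where VW: "open V" "qb \<in> V" "open W" "xb \<in> W" "\<kappa> \<ge> 0"
    and sub: "\<forall>q \<in> Q \<inter> V. \<forall>q' \<in> Q \<inter> V.
      S q' \<inter> W \<subseteq> {x + (\<kappa> * norm (q' - q)) *\<^sub>R b |x b. x \<in> S q \<and> b \<in> cball 0 1}"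
    unfolding lipschitz_like_rel_def by (elim conjE exE)
  obtain e1 e2 where e: "e1 > 0" "ball qb e1 \<subseteq> V" "e2 > 0" "ball xb e2 \<subseteq> W"
    using VW by (meson open_contains_ball)
  have "\<exists>y \<in> S q. norm (x - y) \<le> \<kappa> * norm (q' - q)"
    if "q \<in> Q \<inter> ball qb (min e1 e2)" "q' \<in> Q \<inter> ball qb (min e1 e2)" "x \<in> S q' \<inter> ball xb (min e1 e2)" for q q' x
  proof -
    have "q \<in> Q \<inter> V" "q' \<in> Q \<inter> V" "x \<in> S q' \<inter> W" using that e by auto
    then have "x \<in> {x + (\<kappa> * norm (q' - q)) *\<^sub>R b |x b. x \<in> S q \<and> b \<in> cball 0 1}" using sub by blast
    then show ?thesis using VW(5) by (subst (asm) mem_scaled_cball) auto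
  qed
  then have "\<exists>\<delta> \<kappa>. \<delta> > 0 \<and> \<kappa> \<ge> 0 \<and> (\<forall>q \<in> Q \<inter> ball qb \<delta>. \<forall>q' \<in> Q \<inter> ball qb \<delta>. \<forall>x \<in> S q' \<inter> ball xb \<delta>.
      \<exists>y \<in> S q. norm (x - y) \<le> \<kappa> * norm (q' - q))"
    using e VW(5) by (intro exI[of _ "min e1 e2"] exI[of _ \<kappa>]) simp
  with \<open>?l\<close> show ?r unfolding lipschitz_like_rel_def by blast
next
  assume ?r
  then obtain \<delta> \<kappa> where \<delta>: "\<delta> > 0" "\<kappa> \<ge> 0"
    and *: "\<forall>q \<in> Q \<inter> ball qb \<delta>. \<forall>q' \<in> Q \<inter> ball qb \<delta>. \<forall>x \<in> S q' \<inter> ball xb \<delta>.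
      \<exists>y \<in> S q. norm (x - y) \<le> \<kappa> * norm (q' - q)"
    by (elim conjE exE)
  have sub: "S q' \<inter> ball xb \<delta> \<subseteq> {x + (\<kappa> * norm (q' - q)) *\<^sub>R b |x b. x \<in> S q \<and> b \<in> cball 0 1}"
    if "q \<in> Q \<inter> ball qb \<delta>" "q' \<in> Q \<inter> ball qb \<delta>" for q q'
    using * that \<delta>(2) by (subst subset_iff, subst mem_scaled_cball) auto
  have "qb \<in> Q" "xb \<in> S qb" "locally_closed_at (gph S) (qb, xb)"
    using \<open>?r\<close> by simp_all
  then show ?l
    unfolding lipschitz_like_rel_def
  proof (intro conjI exI[of _ "ball qb \<delta>"] exI[of _ "ball xb \<delta>"] exI[of _ \<kappa>] ballI)
    show "qb \<in> ball qb \<delta>" "xb \<in> ball xb \<delta>" "0 \<le> \<kappa>"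
      using \<delta> by simp_all
  qed (simp_all only: sub open_ball)
qed

text \<open>A solution is continued along the segment from \<open>q'\<close> to \<open>q\<close>;
  the speed bound keeps it near \<open>xb\<close>, so the feasible step is available all the
  way.\<close>

lemma lipschitz_like_avi_solution:
  fixes C Q :: "(real^'n) set"
  assumes C: "polyhedron C" and Q: "polyhedron Q" "qb \<in> Q" and xb: "xb \<in> avi_solution C M qb"
    and vb: "vb = - (M *v xb) - qb" and K: "K = critical_cone C xb vb"
    and gcf: "generalized_critical_face_condition M K Q qb"
  shows "lipschitz_like_rel (avi_solution C M) Q qb xb"
proof -
  define S where "S = avi_solution C M"
  have "vb = - qb - M *v xb" by (simp add: vb)
  then have nb: "vb \<in> normal_cone C xb" using xb by (simp add: mem_avi_solution[OF C])
  obtain \<epsilon> \<kappa> where \<epsilon>: "\<epsilon> > 0" and \<kappa>: "\<kappa> \<ge> 0" and step: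
    "\<And>q x q'. x \<in> S q \<Longrightarrow> norm (x - xb) < \<epsilon> \<Longrightarrow> norm (- q - M *v x - vb) < \<epsilon> \<Longrightarrow> q' \<in> Q \<Longrightarrow>
      \<exists>w t. norm w \<le> \<kappa> * norm (q' - q) \<and> t > 0 \<and>
        (\<forall>s. 0 \<le> s \<and> s \<le> t \<longrightarrow> x + s *\<^sub>R w \<in> S (q + s *\<^sub>R (q' - q)))"
    unfolding S_def using avi_solution_feasible_step[OF C Q nb vb K gcf] by blast
  have M: "linear ((*v) M)" by (rule matrix_vector_mul_linear)
  obtain B where B: "B > 0" "\<And>x. norm (M *v x) \<le> B * norm x"
    using linear_bounded_pos[OF M] by blast
  \<comment> \<open>In units of \<open>\<delta>\<close>, \<open>c\<close> bounds both the distance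
    of the tracked point from \<open>xb\<close> and that of its normal vector from
    \<open>vb\<close>.\<close>
  define c where "c = (1 + B) * (1 + 2 * \<kappa>)"
  have c: "c \<ge> 1 + 2 * \<kappa>" "c \<ge> 1 + B * (1 + 2 * \<kappa>)"
    using B(1) \<kappa> by (auto simp: c_def algebra_simps)
  define \<delta> where "\<delta> = \<epsilon> / (2 * c)"
  have \<delta>: "\<delta> > 0" "c * \<delta> < \<epsilon>" using \<epsilon> c(1) \<kappa> by (auto simp: \<delta>_def)
  have "\<exists>y \<in> S q. norm (x - y) \<le> \<kappa> * norm (q' - q)"
    if q: "q \<in> Q \<inter> ball qb \<delta>" and q': "q' \<in> Q \<inter> ball qb \<delta>" and x: "x \<in> S q' \<inter> ball xb \<delta>" for q q' x
  proof -
    define d where "d = q - q'"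
    have "norm d \<le> norm (q - qb) + norm (qb - q')" 
      using norm_triangle_ineq[of "q - qb" "qb - q'"] by (simp add: d_def)
    also have "\<dots> \<le> 2 * \<delta>" using q q' by (simp add: dist_norm norm_minus_commute)
    finally have d: "norm d \<le> 2 * \<delta>" .
    have "\<exists>y\<in>S (q' + d). norm (y - x) \<le> \<kappa> * norm d"
    proof (rule segment_continuation[OF _ \<kappa>])
      show "closed (gph S)" unfolding S_def by (rule closed_gph_avi_solution[OF C])
      show "x \<in> S q'" using x by blast
      fix s y assume s: "0 \<le> s" "s < (1::real)" and y: "y \<in> S (q' + s *\<^sub>R d)" "norm (y - x) \<le> \<kappa> * (s * norm d)"
      define p where "p = q' + s *\<^sub>R d"
      have "p = (1 - s) *\<^sub>R q' + s *\<^sub>R q" by (simp add: p_def d_def algebra_simps)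
      then have "p \<in> ball qb \<delta>" using convexD[OF convex_ball, of q' qb \<delta> q "1 - s" s] q q' s by simp
      then have pb: "norm (p - qb) < \<delta>" by (simp add: dist_norm norm_minus_commute)
      have "s * norm d \<le> 1 * (2 * \<delta>)" using s d by (intro mult_mono) auto
      then have "\<kappa> * (s * norm d) \<le> \<kappa> * (2 * \<delta>)" using \<kappa> by (intro mult_left_mono) auto
      then have "norm (y - x) \<le> 2 * \<kappa> * \<delta>" using y(2) by linarith
      moreover have "norm (x - xb) < \<delta>" using x by (simp add: dist_norm norm_minus_commute)
      ultimately have yb: "norm (y - xb) < (1 + 2 * \<kappa>) * \<delta>"
        using norm_triangle_ineq[of "y - x" "x - xb"] by (simp add: algebra_simps)
      have "(1 + 2 * \<kappa>) * \<delta> \<le> c * \<delta>" using c(1) \<delta>(1) by (intro mult_right_mono) auto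
      then have y\<epsilon>: "norm (y - xb) < \<epsilon>" using yb \<delta>(2) by linarith
      have "- p - M *v y - vb = - ((p - qb) + M *v (y - xb))"
        by (simp add: vb linear_diff[OF M])
      then have "norm (- p - M *v y - vb) = norm ((p - qb) + M *v (y - xb))"
        by (simp only: norm_minus_cancel)
      also have "\<dots> \<le> norm (p - qb) + B * norm (y - xb)"
        using B(2)[of "y - xb"] norm_triangle_ineq[of "p - qb" "M *v (y - xb)"] by linarith
      also have "\<dots> < \<delta> + B * ((1 + 2 * \<kappa>) * \<delta>)"
        using pb yb B(1) by (intro add_strict_mono mult_strict_left_mono) auto
      also have "\<dots> = (1 + B * (1 + 2 * \<kappa>)) * \<delta>" by (simp add: algebra_simps)
      also have "\<dots> \<le> c * \<delta>" using c(2) \<delta>(1) by (intro mult_right_mono) auto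
      finally have v\<epsilon>: "norm (- p - M *v y - vb) < \<epsilon>" using \<delta>(2) by linarith
      obtain w t where w: "norm w \<le> \<kappa> * norm (q - p)" "t > 0"
        "\<And>r. 0 \<le> r \<Longrightarrow> r \<le> t \<Longrightarrow> y + r *\<^sub>R w \<in> S (p + r *\<^sub>R (q - p))"
        using step[OF y(1)[folded p_def] y\<epsilon> v\<epsilon>, of q] q by blast
      have qp: "q - p = (1 - s) *\<^sub>R d" by (simp add: p_def d_def algebra_simps)
      \<comment> \<open>The step was taken towards \<open>q\<close>, with only
        \<open>(1 - s) d\<close> remaining; division by \<open>1 - s\<close> restores the velocity
        with respect to \<open>d\<close>.\<close>
      define w' where "w' = w /\<^sub>R (1 - s)"
      have "norm w \<le> (1 - s) * (\<kappa> * norm d)"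
        using w(1) s unfolding qp norm_scaleR by (simp add: mult.left_commute)
      then have "norm w / (1 - s) \<le> \<kappa> * norm d"
        using s by (simp add: pos_divide_le_eq mult.commute)
      moreover have "norm w' = norm w / (1 - s)"
        using s by (simp add: w'_def divide_inverse mult.commute)
      ultimately have "norm w' \<le> \<kappa> * norm d" by simp
      moreover have "y + r *\<^sub>R w' \<in> S (p + r *\<^sub>R d)" if "0 \<le> r" "r \<le> t * (1 - s)" for r
      proof -
        have "0 \<le> r / (1 - s)" "r / (1 - s) \<le> t" using that s by (auto simp: pos_divide_le_eq)
        moreover have "(r / (1 - s)) *\<^sub>R w = r *\<^sub>R w'" "(r / (1 - s)) *\<^sub>R (q - p) = r *\<^sub>R d"
          using s by (simp_all add: w'_def qp divide_inverse)
        ultimately show ?thesis using w(3)[of "r / (1 - s)"] by metis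
      qed
      moreover have "t * (1 - s) > 0" using w(2) s by simp
      ultimately show "\<exists>w t. norm w \<le> \<kappa> * norm d \<and> t > 0 \<and>
          (\<forall>r. 0 \<le> r \<and> r \<le> t \<longrightarrow> y + r *\<^sub>R w \<in> S (q' + s *\<^sub>R d + r *\<^sub>R d))"
        unfolding p_def by blast
    qed
    then show ?thesis by (simp add: d_def norm_minus_commute)
  qed
  then show ?thesis
    unfolding lipschitz_like_rel_iff locally_closed_at_def S_def[symmetric]
    using Q(2) xb \<delta>(1) \<kappa> closed_gph_avi_solution[OF C, of M]
    by (intro conjI exI[of _ "1::real"] exI[of _ \<delta>] exI[of _ \<kappa>]) (auto simp: S_def closed_Int)
qed

section \<open>Necessity of the face condition\<close>

text \<open>A small move towards \<open>q'\<close> has a solution close to \<open>x\<close>, whose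
  displacement \<open>u\<close> and normal change \<open>n\<close> satisfy the conic inclusion over
  the critical cone. Pairing \<open>t d = - n - M u\<close> with \<open>z\<close> shows the sign, as
  both products on the right are nonpositive before negation.\<close>

lemma lipschitz_like_avi_solution_residual:
  fixes C Q :: "(real^'n) set"
  assumes C: "polyhedron C" and Q: "convex Q"
    and lip: "lipschitz_like_rel (avi_solution C M) Q qb xb"
  obtains \<epsilon> where "\<epsilon> > 0"
    "\<And>q x v z q'. v \<in> normal_cone C x \<Longrightarrow> v = - q - M *v x \<Longrightarrow> q \<in> Q \<Longrightarrow>
      norm (x - xb) < \<epsilon> \<Longrightarrow> norm (q - qb) < \<epsilon> \<Longrightarrow>
      z \<in> critical_cone C x v \<Longrightarrow> z \<in> polar_cone ((*v) M ` critical_cone C x v) \<Longrightarrow> q' \<in> Q \<Longrightarrow>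
      z \<bullet> (q' - q) \<ge> 0"
proof -
  have M: "linear ((*v) M)" by (rule matrix_vector_mul_linear)
  obtain B where B: "B > 0" "\<And>x. norm (M *v x) \<le> B * norm x"
    using linear_bounded_pos[OF M] by blast
  obtain \<delta> \<kappa> where \<delta>: "\<delta> > 0" "\<kappa> \<ge> 0"
    and lip': "\<And>q q' x. q \<in> Q \<inter> ball qb \<delta> \<Longrightarrow> q' \<in> Q \<inter> ball qb \<delta> \<Longrightarrow>
      x \<in> avi_solution C M q' \<inter> ball xb \<delta> \<Longrightarrow>
      \<exists>y \<in> avi_solution C M q. norm (x - y) \<le> \<kappa> * norm (q' - q)"
    using lip unfolding lipschitz_like_rel_iff by blast
  have "z \<bullet> (q' - q) \<ge> 0"
    if v: "v \<in> normal_cone C x" "v = - q - M *v x" and q: "q \<in> Q" "norm (q - qb) < \<delta>"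
      and x: "norm (x - xb) < \<delta>" and z: "z \<in> critical_cone C x v"
        "z \<in> polar_cone ((*v) M ` critical_cone C x v)" and q': "q' \<in> Q" for q x v z q'
  proof -
    define d where "d = q' - q"
    define L where "L = critical_cone C x v"
    have xC: "x \<in> C" using v(1) by (simp add: normal_cone_def)
    note Lc = polyhedron_critical_cone[OF C xC, of v, folded L_def]
    obtain \<epsilon> where \<epsilon>: "\<epsilon> > 0" "\<And>u n. norm u < \<epsilon> \<Longrightarrow> norm n < \<epsilon> \<Longrightarrow>
        v + n \<in> normal_cone C (x + u) \<longleftrightarrow> n \<in> normal_cone L u"
      using normal_cone_reduction[OF C v(1)] unfolding L_def by metis
    \<comment> \<open>With \<open>norm u\<close> at most \<open>\<kappa>\<close> times and
      \<open>norm n\<close> at most \<open>1 + B * \<kappa>\<close> times the length of the move,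
      \<open>c\<close> covers both.\<close>
    define c where "c = 1 + \<kappa> + B * \<kappa>"
    have "c \<ge> 1" using B(1) \<delta>(2) by (simp add: c_def)
    then have "min (\<delta> - norm (q - qb)) (\<epsilon> / c) > 0" using q(2) \<epsilon>(1) by simp
    then obtain t where t: "0 < t" "t \<le> 1" "norm (t *\<^sub>R d) < \<delta> - norm (q - qb)" "norm (t *\<^sub>R d) < \<epsilon> / c"
      using small_scale[of "min (\<delta> - norm (q - qb)) (\<epsilon> / c)" d] by auto
    have "q + t *\<^sub>R d = (1 - t) *\<^sub>R q + t *\<^sub>R q'" by (simp add: d_def algebra_simps)
    also have "\<dots> \<in> Q" using Q q(1) q' t by (intro convexD) auto
    finally have "q + t *\<^sub>R d \<in> Q" .
    moreover have "norm (q + t *\<^sub>R d - qb) < \<delta>"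
      using norm_triangle_ineq[of "q - qb" "t *\<^sub>R d"] t(3) by (simp add: algebra_simps)
    ultimately have "q + t *\<^sub>R d \<in> Q \<inter> ball qb \<delta>" "q \<in> Q \<inter> ball qb \<delta>" "x \<in> avi_solution C M q \<inter> ball xb \<delta>"
      using q x v by (auto simp: dist_norm norm_minus_commute mem_avi_solution[OF C])
    from lip'[OF this] obtain y where y: "y \<in> avi_solution C M (q + t *\<^sub>R d)" "norm (x - y) \<le> \<kappa> * norm (t *\<^sub>R d)"
      by auto
    define u where "u = y - x"
    define n where "n = - (t *\<^sub>R d) - M *v u"
    have ct: "c * norm (t *\<^sub>R d) < \<epsilon>" using t(4) \<open>c \<ge> 1\<close> by (simp add: pos_less_divide_eq mult.commute)
    have u1: "norm u \<le> \<kappa> * norm (t *\<^sub>R d)" using y(2) by (simp add: u_def norm_minus_commute)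
    have "B * norm u \<le> B * (\<kappa> * norm (t *\<^sub>R d))" using u1 B(1) by (intro mult_left_mono) auto
    then have "norm (M *v u) \<le> B * (\<kappa> * norm (t *\<^sub>R d))" using B(2)[of u] by linarith
    moreover have "norm n \<le> norm (t *\<^sub>R d) + norm (M *v u)"
      unfolding n_def using norm_triangle_ineq4[of "- (t *\<^sub>R d)" "M *v u"] by simp
    moreover have "c * norm (t *\<^sub>R d) = norm (t *\<^sub>R d) + \<kappa> * norm (t *\<^sub>R d) + B * (\<kappa> * norm (t *\<^sub>R d))"
      by (simp add: c_def algebra_simps)
    moreover have "0 \<le> norm (t *\<^sub>R d)" "0 \<le> \<kappa> * norm (t *\<^sub>R d)" "0 \<le> B * (\<kappa> * norm (t *\<^sub>R d))"
      using \<delta>(2) B(1) by auto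
    ultimately have "norm u < \<epsilon>" "norm n < \<epsilon>" using ct u1 by linarith+
    moreover have "v + n = - (q + t *\<^sub>R d) - M *v y" "x + u = y"
      by (simp_all add: v(2) n_def u_def linear_diff[OF M])
    ultimately have "n \<in> normal_cone L u"
      using \<epsilon>(2)[of u n] y(1) by (simp add: mem_avi_solution[OF C])
    then have "u \<in> L" "n \<in> polar_cone L" using normal_cone_convex_cone[OF Lc(2)] by auto
    then have "z \<bullet> (M *v u) \<le> 0" "n \<bullet> z \<le> 0"
      using z unfolding L_def[symmetric] polar_cone_def by blast+
    moreover have "t *\<^sub>R d = - n - M *v u" by (simp add: n_def)
    then have "t * (z \<bullet> d) = - (n \<bullet> z) - z \<bullet> (M *v u)"
      by (metis inner_commute inner_diff_right inner_minus_right inner_scaleR_right)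
    ultimately have "t * (z \<bullet> d) \<ge> 0" by simp
    then show ?thesis using t(1) by (simp add: zero_le_mult_iff d_def)
  qed
  with \<delta>(1) show thesis using that by blast
qed

text \<open>Each pair in the graph of the normal cone map of \<open>K\<close>, scaled down, yields a
  solution near \<open>xb\<close> for some \<open>q\<close>. This \<open>q\<close> lies in
  \<open>Q\<close> because \<open>Q\<close> is the whole domain, so the residual inequality holds at
  that point.\<close>

lemma critical_face_condition_mdom:
  fixes C Q :: "(real^'n) set"
  assumes C: "polyhedron C" and Q: "polyhedron Q" "Q = mdom (avi_solution C M)" and xb: "xb \<in> avi_solution C M qb"
    and vb: "vb = - (M *v xb) - qb" and K: "K = critical_cone C xb vb"
    and lip: "lipschitz_like_rel (avi_solution C M) Q qb xb"
  shows "generalized_critical_face_condition M K Q qb"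
proof -
  have M: "linear ((*v) M)" by (rule matrix_vector_mul_linear)
  have qb: "qb \<in> Q" using lip by (simp add: lipschitz_like_rel_def)
  have "vb = - qb - M *v xb" by (simp add: vb)
  then have nb: "vb \<in> normal_cone C xb" using xb by (simp add: mem_avi_solution[OF C])
  then have "xb \<in> C" by (simp add: normal_cone_def)
  note Kc = polyhedron_critical_cone[OF C this, of vb, folded K]
  obtain \<epsilon> where \<epsilon>: "\<epsilon> > 0"
    "\<And>u v. norm u < \<epsilon> \<Longrightarrow> norm v < \<epsilon> \<Longrightarrow> vb + v \<in> normal_cone C (xb + u) \<longleftrightarrow> v \<in> normal_cone K u"
    "\<And>u v. norm u < \<epsilon> \<Longrightarrow> norm v < \<epsilon> \<Longrightarrow> v \<in> normal_cone K u \<Longrightarrow>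
      critical_cone C (xb + u) (vb + v) = critical_cone K u v"
    using normal_cone_reduction[OF C nb] unfolding K by blast
  obtain \<delta> where \<delta>: "\<delta> > 0"
    "\<And>q x v z q'. v \<in> normal_cone C x \<Longrightarrow> v = - q - M *v x \<Longrightarrow> q \<in> Q \<Longrightarrow>
      norm (x - xb) < \<delta> \<Longrightarrow> norm (q - qb) < \<delta> \<Longrightarrow>
      z \<in> critical_cone C x v \<Longrightarrow> z \<in> polar_cone ((*v) M ` critical_cone C x v) \<Longrightarrow> q' \<in> Q \<Longrightarrow>
      z \<bullet> (q' - q) \<ge> 0"
    using lipschitz_like_avi_solution_residual[OF C polyhedron_imp_convex[OF Q(1)] lip] by metis
  have "z \<bullet> (q' - qb) \<ge> 0"
    if n: "v \<in> normal_cone K u" and z: "z \<in> critical_cone K u v"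
      "z \<in> polar_cone ((*v) M ` critical_cone K u v)" and q': "q' \<in> Q" for u v z q'
  proof -
    have uK: "u \<in> K" using n by (simp add: normal_cone_def)
    have "min \<epsilon> \<delta> > 0" using \<epsilon>(1) \<delta>(1) by simp
    \<comment> \<open>The third component is the displacement of \<open>q\<close> that makes
      \<open>vb + t v\<close> equal to \<open>- q - M x\<close>.\<close>
    then obtain t where t: "0 < t" "norm (t *\<^sub>R (u, v, - v - M *v u)) < min \<epsilon> \<delta>"
      using small_scale by metis
    have "norm (t *\<^sub>R u) \<le> norm (t *\<^sub>R (u, v, - v - M *v u))"
      "norm (t *\<^sub>R (v, - v - M *v u)) \<le> norm (t *\<^sub>R (u, v, - v - M *v u))"
      "norm (t *\<^sub>R v) \<le> norm (t *\<^sub>R (v, - v - M *v u))"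
      "norm (t *\<^sub>R (- v - M *v u)) \<le> norm (t *\<^sub>R (v, - v - M *v u))"
      by (simp_all only: scaleR_Pair norm_fst_le norm_snd_le)
    with t(2) have small: "norm (t *\<^sub>R u) < \<epsilon>" "norm (t *\<^sub>R v) < \<epsilon>" "norm (t *\<^sub>R u) < \<delta>"
      "norm (t *\<^sub>R (- v - M *v u)) < \<delta>"
      by linarith+
    define x where "x = xb + t *\<^sub>R u"
    define q where "q = qb + t *\<^sub>R (- v - M *v u)"
    have tn: "t *\<^sub>R v \<in> normal_cone K (t *\<^sub>R u)" using normal_cone_scaleR[OF Kc(2) n] t(1) by simp
    have nx: "vb + t *\<^sub>R v \<in> normal_cone C x" using \<epsilon>(2)[OF small(1,2)] tn by (simp add: x_def)
    have vq: "vb + t *\<^sub>R v = - q - M *v x"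
      by (simp add: x_def q_def vb linear_add[OF M] linear_scale[OF M] algebra_simps)
    have "x \<in> avi_solution C M q" using nx by (simp add: mem_avi_solution[OF C] vq)
    then have qQ: "q \<in> Q" unfolding Q(2) mdom_def by blast
    have eq: "critical_cone C x (vb + t *\<^sub>R v) = critical_cone K u v"
      unfolding x_def \<epsilon>(3)[OF small(1,2) tn] by (rule critical_cone_scaleR[OF Kc uK t(1)])
    have "z \<bullet> (q' - q) \<ge> 0"
      by (rule \<delta>(2)[OF nx vq qQ]) (use small z q' in \<open>simp_all add: x_def q_def eq[unfolded x_def]\<close>)
    moreover have "z \<bullet> (q - qb) = 0"
    proof -
      note lin = critical_cone_lineality[OF Kc n]
      have "z \<bullet> (M *v u) \<le> 0" "z \<bullet> (M *v (- u)) \<le> 0"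
        using z(2) lin(1,2) unfolding polar_cone_def by blast+
      then have "z \<bullet> (M *v u) = 0" by (simp add: linear_neg[OF M])
      with lin(3)[OF z(1)] show ?thesis by (simp add: q_def inner_diff_right inner_commute[of z v])
    qed
    ultimately show ?thesis by (simp add: inner_diff_right)
  qed
  then show ?thesis unfolding generalized_critical_face_condition_iff[OF Q(1) qb Kc] by blast
qed

section \<open>Necessity when the normal cone graph is regular\<close>

text \<open>Near \<open>(x, v)\<close> the graph is a translate of that of the normal cone map of
  \<open>L\<close>, whose normals are polar to \<open>L\<close>; so tangent directions have second
  components with nonpositive product with \<open>e\<close>.\<close>

lemma critical_cone_regular_normal:
  fixes C :: "'a::euclidean_space set"
  assumes C: "polyhedron C" and v: "v \<in> normal_cone C x" and e: "e \<in> critical_cone C x v"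
  shows "(0, e) \<in> regular_normal_cone (gph (normal_cone C)) (x, v)"
proof -
  define L where "L = critical_cone C x v"
  have xC: "x \<in> C" using v by (simp add: normal_cone_def)
  note Lc = polyhedron_critical_cone[OF C xC, of v, folded L_def]
  obtain \<epsilon> where \<epsilon>: "\<epsilon> > 0" "\<And>u n. norm u < \<epsilon> \<Longrightarrow> norm n < \<epsilon> \<Longrightarrow>
      v + n \<in> normal_cone C (x + u) \<longleftrightarrow> n \<in> normal_cone L u"
    using normal_cone_reduction[OF C v] unfolding L_def by metis
  have "(0, e) \<bullet> w \<le> 0" if w: "w \<in> contingent_cone (gph (normal_cone C)) (x, v)" for w
  proof -
    from w obtain t u where tu: "\<forall>k::nat. t k > 0" "t \<longlonglongrightarrow> 0" "u \<longlonglongrightarrow> w"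
      "\<forall>k. (x, v) + t k *\<^sub>R u k \<in> gph (normal_cone C)"
      unfolding contingent_cone_def by blast
    have "(\<lambda>k. t k *\<^sub>R u k) \<longlonglongrightarrow> 0 *\<^sub>R w" by (intro tendsto_intros tu)
    then have "\<forall>\<^sub>F k in sequentially. norm (t k *\<^sub>R u k) < \<epsilon>"
      using \<epsilon>(1) by (auto dest!: tendstoD[where e = \<epsilon>])
    then have "\<forall>\<^sub>F k in sequentially. (0, e) \<bullet> u k \<le> 0"
    proof (rule eventually_mono)
      fix k assume k: "norm (t k *\<^sub>R u k) < \<epsilon>"
      have "norm (t k *\<^sub>R fst (u k)) < \<epsilon>" "norm (t k *\<^sub>R snd (u k)) < \<epsilon>"
        using k norm_fst_le[of "t k *\<^sub>R fst (u k)" "t k *\<^sub>R snd (u k)"]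
          norm_snd_le[of "t k *\<^sub>R snd (u k)" "t k *\<^sub>R fst (u k)"]
        by (simp_all flip: scaleR_Pair)
      then have "t k *\<^sub>R snd (u k) \<in> normal_cone L (t k *\<^sub>R fst (u k))"
        using tu(4)[rule_format, of k] by (simp add: \<epsilon>(2)[symmetric] mem_gph)
      then have "t k *\<^sub>R snd (u k) \<in> polar_cone L" using normal_cone_convex_cone[OF Lc(2)] by blast
      then have "(t k *\<^sub>R snd (u k)) \<bullet> e \<le> 0" using e unfolding polar_cone_def L_def by blast
      then show "(0, e) \<bullet> u k \<le> 0"
        using tu(1)[rule_format, of k] by (simp add: inner_prod_def mult_le_0_iff inner_commute)
    qed
    moreover have "(\<lambda>k. (0, e) \<bullet> u k) \<longlonglongrightarrow> (0, e) \<bullet> w" by (intro tendsto_intros tu)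
    ultimately show ?thesis using tendsto_upperbound trivial_limit_sequentially by blast
  qed
  then show ?thesis
    using v by (simp add: regular_normal_cone_def polar_cone_def mem_gph)
qed

text \<open>For \<open>u \<in> K\<close>, \<open>(0, - u)\<close> is a regular normal at the points \<open>(xb + t u, vb)\<close>; by regularity it is
  one at the limit \<open>(xb, vb)\<close>, which forces \<open>- u \<in> K\<close>.\<close>

lemma regular_around_critical_cone_symmetric:
  fixes C :: "'a::euclidean_space set"
  assumes C: "polyhedron C" and vb: "vb \<in> normal_cone C xb" and K: "K = critical_cone C xb vb"
    and reg: "regular_around (gph (normal_cone C)) (xb, vb)" and u: "u \<in> K"
  shows "- u \<in> K"
proof -
  define D where "D = gph (normal_cone C)"
  have xC: "xb \<in> C" using vb by (simp add: normal_cone_def)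
  note Kc = polyhedron_critical_cone[OF C xC, of vb, folded K]
  have D: "(xb, vb) \<in> D" using vb by (simp add: D_def mem_gph)
  have eqD: "regular_normal_cone D (xb, vb) = limiting_normal_cone D (xb, vb)"
    using reg D unfolding regular_around_def D_def by fastforce
  obtain t where t: "t > 0" "\<And>s. 0 \<le> s \<Longrightarrow> s \<le> t \<Longrightarrow> vb \<in> normal_cone C (xb + s *\<^sub>R u)"
    using u unfolding K mem_critical_cone_normal_cone[OF C vb] by blast
  define \<tau> where "\<tau> k = t * inverse (real (Suc k))" for k
  have \<tau>: "0 < \<tau> k" "\<tau> k \<le> t" for k using t(1) by (auto simp: \<tau>_def field_simps)
  have \<tau>0: "\<tau> \<longlonglongrightarrow> 0"
    unfolding \<tau>_def using tendsto_mult_right_zero[OF LIMSEQ_inverse_real_of_nat] .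
  have reg_k: "(0, - u) \<in> regular_normal_cone D (xb + \<tau> k *\<^sub>R u, vb)" for k
    unfolding D_def
  proof (rule critical_cone_regular_normal[OF C])
    show n: "vb \<in> normal_cone C (xb + \<tau> k *\<^sub>R u)" using t(2)[of "\<tau> k"] \<tau>[of k] by simp
    then have "xb + \<tau> k *\<^sub>R u \<in> C" by (simp add: normal_cone_def)
    from mem_critical_cone[OF C this]
    \<comment> \<open>Moving back by \<open>\<tau> k\<close> along \<open>- u\<close> returns to
      \<open>xb\<close>, a point of \<open>C\<close>.\<close>
    show "- u \<in> critical_cone C (xb + \<tau> k *\<^sub>R u) vb"
      using u xC \<tau>(1)[of k] mem_critical_cone[OF C xC, of u vb] unfolding K
      by (auto intro!: exI[of _ "\<tau> k"])
  qed
  define f where "f k = (xb + \<tau> k *\<^sub>R u, vb)" for k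
  have fD: "f k \<in> D" for k
    using reg_k[of k] unfolding f_def regular_normal_cone_def by (metis empty_iff)
  have "f \<longlonglongrightarrow> (xb + 0 *\<^sub>R u, vb)"
    unfolding f_def by (intro tendsto_intros \<tau>0)
  then have "(\<forall>k. f k \<in> D \<and> (0, - u) \<in> regular_normal_cone D (f k)) \<and> f \<longlonglongrightarrow> (xb, vb) \<and>
      (\<lambda>_. (0, - u)) \<longlonglongrightarrow> (0 :: 'a, - u)"
    using reg_k fD by (simp add: f_def)
  then have "\<exists>y w. (\<forall>k. y k \<in> D \<and> w k \<in> regular_normal_cone D (y k)) \<and> y \<longlonglongrightarrow> (xb, vb) \<and> w \<longlonglongrightarrow> (0, - u)"
    by (rule exI[of _ f, OF exI[of _ "\<lambda>_. (0, - u)"]])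
  with D have "(0, - u) \<in> limiting_normal_cone D (xb, vb)"
    unfolding limiting_normal_cone_def by simp
  then have pol: "(0, - u) \<in> polar_cone (contingent_cone D (xb, vb))"
    using eqD D by (simp add: regular_normal_cone_def)
  obtain \<epsilon> where \<epsilon>: "\<epsilon> > 0" "\<And>u n. norm u < \<epsilon> \<Longrightarrow> norm n < \<epsilon> \<Longrightarrow>
      vb + n \<in> normal_cone C (xb + u) \<longleftrightarrow> n \<in> normal_cone K u"
    using normal_cone_reduction[OF C vb] unfolding K by metis
  \<comment> \<open>At the base point 0 of \<open>K\<close> all polar vectors are normal, so
    \<open>(0, n)\<close> is tangent to \<open>D\<close>. Hence \<open>- u\<close> is polar to the
    polar cone of \<open>K\<close>, and the bipolar theorem applies.\<close>
  have "(- u) \<bullet> n \<le> 0" if n: "n \<in> polar_cone K" for n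
  proof -
    obtain r where r: "0 < r" "\<And>s. 0 \<le> s \<Longrightarrow> s \<le> r \<Longrightarrow> norm (s *\<^sub>R n) < \<epsilon> \<and> norm (s *\<^sub>R n) < \<epsilon>"
      using small_scale_pair[OF \<epsilon>(1)] by metis
    define \<sigma> where "\<sigma> k = r * inverse (real (Suc k))" for k
    have \<sigma>: "0 < \<sigma> k" "\<sigma> k \<le> r" for k using r(1) by (auto simp: \<sigma>_def field_simps)
    have \<sigma>0: "\<sigma> \<longlonglongrightarrow> 0"
      unfolding \<sigma>_def using tendsto_mult_right_zero[OF LIMSEQ_inverse_real_of_nat] .
    have "(xb, vb) + \<sigma> k *\<^sub>R (0, n) \<in> D" for k
    proof -
      have "\<sigma> k *\<^sub>R n \<in> polar_cone K"
        using convex_cone_scaleR[OF convex_cone_polar_cone _ n] \<sigma>(1)[of k] by simp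
      then have "\<sigma> k *\<^sub>R n \<in> normal_cone K 0"
        using convex_cone_contains_0[OF Kc(2)] normal_cone_convex_cone[OF Kc(2)] by simp
      then show ?thesis
        using \<epsilon>(2)[of 0 "\<sigma> k *\<^sub>R n"] r(2)[of "\<sigma> k"] \<sigma>[of k] \<epsilon>(1) by (simp add: D_def mem_gph)
    qed
    then have "(0, n) \<in> contingent_cone D (xb, vb)"
      unfolding contingent_cone_def using \<sigma>(1) \<sigma>0
      by (intro CollectI exI[of _ \<sigma>] exI[of _ "\<lambda>_. (0, n)"]) auto
    with pol have "(0, - u) \<bullet> (0 :: 'a, n) \<le> 0" unfolding polar_cone_def by blast
    then show ?thesis by simp
  qed
  then have "- u \<in> polar_cone (polar_cone K)" unfolding polar_cone_def[of "polar_cone K"] by blast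
  then show ?thesis by (rule polar_polar_cone[OF polyhedron_imp_closed[OF Kc(1)] Kc(2)])
qed

text \<open>Symmetry makes \<open>K\<close> a subspace: normals are orthogonal to it and every
  critical cone of \<open>K\<close> is \<open>K\<close> itself. The residual inequality at the
  reference point then covers all cases.\<close>

lemma critical_face_condition_regular:
  fixes C Q :: "(real^'n) set"
  assumes C: "polyhedron C" and Q: "polyhedron Q" and xb: "xb \<in> avi_solution C M qb"
    and vb: "vb = - (M *v xb) - qb" and K: "K = critical_cone C xb vb"
    and reg: "regular_around (gph (normal_cone C)) (xb, vb)"
    and lip: "lipschitz_like_rel (avi_solution C M) Q qb xb"
  shows "generalized_critical_face_condition M K Q qb"
proof -
  have qb: "qb \<in> Q" using lip by (simp add: lipschitz_like_rel_def)
  have vb': "vb = - qb - M *v xb" by (simp add: vb)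
  have nb: "vb \<in> normal_cone C xb" using xb by (simp add: mem_avi_solution[OF C] vb')
  then have "xb \<in> C" by (simp add: normal_cone_def)
  note Kc = polyhedron_critical_cone[OF C this, of vb, folded K]
  have sym: "- u \<in> K" if "u \<in> K" for u
    by (rule regular_around_critical_cone_symmetric[OF C nb K reg that])
  have crit: "critical_cone K u v = K" if n: "v \<in> normal_cone K u" for u v
  proof -
    have uv: "u \<in> K" "v \<in> polar_cone K" using n normal_cone_convex_cone[OF Kc(2)] by auto
    have "v \<bullet> w \<le> 0" "v \<bullet> (- w) \<le> 0" if "w \<in> K" for w
      using uv(2) that sym[OF that] unfolding polar_cone_def by blast+
    then have vw: "v \<bullet> w = 0" if "w \<in> K" for w using that by (simp add: antisym)
    have "w \<in> K" if t: "t > 0" "u + t *\<^sub>R w \<in> K" for w t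
    proof -
      have "t *\<^sub>R w \<in> K" using convex_cone_add[OF Kc(2) sym[OF uv(1)] t(2)] by simp
      from convex_cone_scaleR[OF Kc(2) _ this, of "inverse t"] t(1) show ?thesis by simp
    qed
    moreover have "u + 1 *\<^sub>R w \<in> K" if "w \<in> K" for w
      using convex_cone_add[OF Kc(2) uv(1) that] by simp
    ultimately show ?thesis
      using mem_critical_cone[OF Kc(1) uv(1)] vw zero_less_one by blast
  qed
  obtain \<delta> where \<delta>: "\<delta> > 0"
    "\<And>q x v z q'. v \<in> normal_cone C x \<Longrightarrow> v = - q - M *v x \<Longrightarrow> q \<in> Q \<Longrightarrow>
      norm (x - xb) < \<delta> \<Longrightarrow> norm (q - qb) < \<delta> \<Longrightarrow>
      z \<in> critical_cone C x v \<Longrightarrow> z \<in> polar_cone ((*v) M ` critical_cone C x v) \<Longrightarrow> q' \<in> Q \<Longrightarrow>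
      z \<bullet> (q' - q) \<ge> 0"
    using lipschitz_like_avi_solution_residual[OF C polyhedron_imp_convex[OF Q] lip] by metis
  have "z \<bullet> (q' - qb) \<ge> 0" if "z \<in> K" "z \<in> polar_cone ((*v) M ` K)" "q' \<in> Q" for z q'
    using \<delta>(2)[OF nb vb' qb] \<delta>(1) that by (simp add: K)
  then show ?thesis
    unfolding generalized_critical_face_condition_iff[OF Q qb Kc] using crit by auto
qed

theorem theorem4p4:
  fixes C Q :: "(real^'n) set" and M :: "real^'n^'n" and qb xb vb :: "real^'n"
    and S :: "real^'n \<Rightarrow> (real^'n) set" and K :: "(real^'n) set"
  assumes "polyhedron C"
    and "S = avi_solution C M"
    and "polyhedron Q"
    and "Q \<subseteq> mdom S"
    and "(qb, xb) \<in> gph (mrestrict S Q)"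
    and "vb = - (M *v xb) - qb"
    and "K = critical_cone C xb vb"
  shows
    "(constraint_qualification M K Q qb \<longrightarrow> generalized_critical_face_condition M K Q qb \<longrightarrow>
        lipschitz_like_rel S Q qb xb) \<and>
     (constraint_qualification M K Q qb \<longrightarrow>
        regular_around (gph (limiting_normal_cone C)) (xb, vb) \<longrightarrow>
        lipschitz_like_rel S Q qb xb \<longrightarrow> generalized_critical_face_condition M K Q qb) \<and>
     (Q = mdom S \<longrightarrow>
        (lipschitz_like_rel S Q qb xb \<longleftrightarrow> generalized_critical_face_condition M K Q qb))"
proof -
  have qb: "qb \<in> Q" and xb: "xb \<in> avi_solution C M qb"
    using assms(2,5) by (auto simp: gph_def mrestrict_def split: if_splits)
  have "limiting_normal_cone C = normal_cone C"
    using limiting_normal_cone_convex[OF polyhedron_imp_convex polyhedron_imp_closed, OF assms(1) assms(1)]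
    by blast
  then show ?thesis
    using lipschitz_like_avi_solution[OF assms(1,3) qb xb assms(6,7)]
      critical_face_condition_regular[OF assms(1,3) xb assms(6,7)]
      critical_face_condition_mdom[OF assms(1,3) _ xb assms(6,7)]
    unfolding assms(2) by auto
qed

end
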